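(* Let $\boldsymbol{\mu}$ be an $\boldsymbol{l}$-partition of $\boldsymbol{m}$, $j$ an integer, and $\boldsymbol{\gamma}=(\gamma_h)$ with $\gamma_h$ the order of $a_{\mu^{(h)},l_h}^{j}$. Let $\sigma\in S_m$ have cycle type $\rho$ and let $\tau\in S_m$ satisfy $\tau\sigma_\rho\tau^{-1}=\sigma$. Then $$\{\{\boldsymbol{T}\}\in\mathcal{T}(\boldsymbol{\mu}):\sigma\{\boldsymbol{T}\}=\{\boldsymbol{T}\}a_{\boldsymbol{\mu},\boldsymbol{l}}^{-j}\}=\{\{\tau\circ\varphi_j(Y,c)\}:(Y,c)\text{ is a marked }(\rho,\boldsymbol{\gamma},\boldsymbol{l})\text{-tabloid on }\boldsymbol{\mu}\}.$$
   Context: A partition $\mu$ is identified with its Young diagram $\{(i,j)\in\mathbb{N}^2:1\le j\le\mu_i\}$ (box $(i,j)$ in row $i$, column $j$). For a positive integer $l$, $\mu$ is an $l$-partition if for every $i$ the number of $k$ with $\mu_k=i$ is divisible by $l$. Fix $n$-tuples $\boldsymbol{m}=(m_h)$, $\boldsymbol{l}=(l_h)$ of positive integers, $m=\sum_h m_h$. An $\boldsymbol{l}$-partition of $\boldsymbol{m}$ is $\boldsymbol{\mu}=(\mu^{(1)},\ldots,\mu^{(n)})$ with $\mu^{(h)}$ an $l_h$-partition of $m_h$; boxes are triples $(i,j;h)$. A numbering is a bijection $\boldsymbol{T}$ from boxes to $\{1,\ldots,m\}$; the standard numbering $\boldsymbol{t}_{\boldsymbol{\mu}}$ fills $1,\ldots,m$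 row by row left to right, top to bottom, in $\mu^{(1)}$, then $\mu^{(2)}$, etc. Numberings are row-equivalent if each row of each component has the same set of entries; classes $\{\boldsymbol{T}\}$ are tabloids, $\mathcal{T}(\boldsymbol{\mu})$ their set. $S_m$ acts on the left by $\sigma\{\boldsymbol{T}\}=\{\sigma\circ\boldsymbol{T}\}$. For a single $l$-partition $\mu$ with standard numbering $t_\mu$, $a_{\mu,l}$ is the product over boxes $(lq+1,j)\in\mu$ of the cycles $(t_\mu(lq+1,j),\ldots,t_\mu(lq+l,j))$; $a_{\boldsymbol{\mu},\boldsymbol{l}}\in S_m$ is the product over all $h$ and boxes $(l_hq+1,j;h)$ of the cycles $(\boldsymbol{t}_{\boldsymbol{\mu}}(l_hq+1,j;h),\ldots,\boldsymbol{t}_{\boldsymbol{\mu}}(l_hq+l_h,j;h))$. The group $\langle a_{\boldsymbol{\mu},\boldsymbol{l}}\rangle$ acts on the right: writing $\boldsymbol{T}=\tau_{\boldsymbol{T}}\circ\boldsymbol{t}_{\boldsymbol{\mu}}$, $\boldsymbol{T}\sigma=\tau_{\boldsymbol{T}}\sigma\circ\boldsymbol{t}_{\boldsymbol{\mu}}$, $\{\boldsymbol{T}\}\sigma=\{\boldsymbol{T}\sigma\}$ (row $\bar r+l_hq$ of $\mu^{(h)}$ in $\boldsymbol{T}a_{\boldsymbol{\mu},\boldsymbol{l}}$ is row $\overline{r+1}+l_hq$ of $\boldsymbol{T}$, residues in $\{1,\ldots,l_h\}$). For a partition $\rho$ of $m$ and positive integers $\gamma_h\mid l_h$, a $(\rho,\boldsymbol{\gamma},\boldsymbol{l})$-tabloid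 on $\boldsymbol{\mu}$ is a map $Y$ from boxes to $\mathbb{N}$ with: (i) $|Y^{-1}(k)|=\rho_k$ for all $k$; (ii) for each $k$ there exist $h$ and $(i',j')\in\mathbb{N}^2$ with $\gamma_h\mid\rho_k$ and $Y^{-1}(k)=\{(s\,l_h/\gamma_h+i',t+j';h):1\le s\le\gamma_h,1\le t\le\rho_k/\gamma_h\}$; (iii) $Y(i,j;h)\le Y(i,k;h)$ whenever $j\le k$. A marked one is a pair $(Y,c)$ with $c:\{i:\rho_i\ne0\}\to\coprod_h\mathbb{Z}/\gamma_h\mathbb{Z}$, $c(i)\in\mathbb{Z}/\gamma_h\mathbb{Z}$ whenever $Y^{-1}(i)\subset\mu^{(h)}$. Let $n_{\rho,i}=1+\sum_{k<i}\rho_k$, $N_{\rho,i}=\{n_{\rho,i},\ldots,n_{\rho,i}+\rho_i-1\}$, $\sigma_{\rho,i}=(n_{\rho,i},n_{\rho,i}+1,\ldots,n_{\rho,i}+\rho_i-1)$, $\sigma_\rho=\sigma_{\rho,1}\sigma_{\rho,2}\cdots\in S_m$ (of cycle type $\rho$). For a marked $(\rho,\boldsymbol{\gamma},\boldsymbol{l})$-tabloid $(Y,c)$, $\{\varphi_j(Y,c)\}$ is the tabloid obtained as follows: for each $i$ with $\rho_i\ne0$, where $Y^{-1}(i)\subset\mu^{(h)}$, put $n_{\rho,i}$ in the $c(i)$-th row (counted from the top, $c(i)$ read in $\{1,\ldots,\gamma_h\}$) among the $\gamma_h$ rows of $Y^{-1}(i)$; and whenever a number $n$ is in the $(\bar c+ql_h)$-th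 row of $\mu^{(h)}$ ($\bar c\in\{1,\ldots,l_h\}$, $q\in\mathbb{Z}$), put $\sigma_\rho(n)$ in the $(\overline{c-j}+ql_h)$-th row of $\mu^{(h)}$, where $\overline{c-j}\in\{1,\ldots,l_h\}$ is congruent to $\bar c-j$ mod $l_h$. $\varphi_j(Y,c)$ is the representative numbering with entries increasing along each row.
   Formalization: In condition (ii) the offset (i',j') ranges over all integers instead of ℕ², since with s ≥ 1 the first rows could otherwise never be covered when γ_h < l_h (e.g. l=2, j=0, μ=(1,1)) and the claim would be false; also n ≥ 1 is assumed. *)

theory Defs
  imports
    "HOL-Algebra.Sym_Groups"
    "HOL-Algebra.Multiplicative_Group"
    "HOL-Combinatorics.Orbits"
    "HOL-Library.Multiset"
begin

text \<open>
  Parts, rows, columns and components are indexed from 1. A partition is the function listing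
  its parts \<open>\<mu> 1 \<ge> \<mu> 2 \<ge> \<dots>\<close>, eventually 0, with the dummy value \<open>\<mu> 0 = 0\<close>.
  An \<open>n\<close>-tuple is a function of which only the values on \<open>{1..n}\<close> matter.
\<close>

definition partition_of :: "(nat \<Rightarrow> nat) \<Rightarrow> nat \<Rightarrow> bool" where
  "partition_of \<mu> m \<longleftrightarrow>
     \<mu> 0 = 0 \<and> (\<forall>i k. 1 \<le> i \<longrightarrow> i \<le> k \<longrightarrow> \<mu> k \<le> \<mu> i) \<and>
     finite {i. \<mu> i \<noteq> 0} \<and> (\<Sum>i | \<mu> i \<noteq> 0. \<mu> i) = m"

definition l_partition_of :: "nat \<Rightarrow> (nat \<Rightarrow> nat) \<Rightarrow> nat \<Rightarrow> bool" where
  "l_partition_of l \<mu> m \<longleftrightarrow> partition_of \<mu> m \<and> (\<forall>i\<ge>1. l dvd card {k. k \<ge> 1 \<and> \<mu> k = i})"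

definition multi_l_partition_of ::
    "nat \<Rightarrow> (nat \<Rightarrow> nat) \<Rightarrow> (nat \<Rightarrow> nat \<Rightarrow> nat) \<Rightarrow> (nat \<Rightarrow> nat) \<Rightarrow> bool" where
  "multi_l_partition_of n l \<mu> m \<longleftrightarrow> (\<forall>h\<in>{1..n}. l_partition_of (l h) (\<mu> h) (m h))"

definition diagram :: "(nat \<Rightarrow> nat) \<Rightarrow> (nat \<times> nat) set" where
  "diagram \<mu> = {(i, j). 1 \<le> i \<and> 1 \<le> j \<and> j \<le> \<mu> i}"

type_synonym box = "nat \<times> nat \<times> nat"

definition boxes :: "nat \<Rightarrow> (nat \<Rightarrow> nat \<Rightarrow> nat) \<Rightarrow> box set" where
  "boxes n \<mu> = {(i, j, h). h \<in> {1..n} \<and> (i, j) \<in> diagram (\<mu> h)}"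

definition row :: "nat \<Rightarrow> (nat \<Rightarrow> nat \<Rightarrow> nat) \<Rightarrow> nat \<Rightarrow> nat \<Rightarrow> box set" where
  "row n \<mu> h i = {(i', j, h') \<in> boxes n \<mu>. i' = i \<and> h' = h}"

definition numberings :: "nat \<Rightarrow> (nat \<Rightarrow> nat) \<Rightarrow> (nat \<Rightarrow> nat \<Rightarrow> nat) \<Rightarrow> (box \<Rightarrow> nat) set" where
  "numberings n m \<mu> =
     {T \<in> extensional (boxes n \<mu>). bij_betw T (boxes n \<mu>) {1..(\<Sum>h=1..n. m h)}}"

definition std_numbering1 :: "(nat \<Rightarrow> nat) \<Rightarrow> nat \<times> nat \<Rightarrow> nat" where
  "std_numbering1 \<mu> = (\<lambda>(i, j)\<in>diagram \<mu>. (\<Sum>i'\<in>{1..<i}. \<mu> i') + j)"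

definition std_numbering ::
    "nat \<Rightarrow> (nat \<Rightarrow> nat) \<Rightarrow> (nat \<Rightarrow> nat \<Rightarrow> nat) \<Rightarrow> box \<Rightarrow> nat" where
  "std_numbering n m \<mu> =
     (\<lambda>(i, j, h)\<in>boxes n \<mu>. (\<Sum>h'\<in>{1..<h}. m h') + std_numbering1 (\<mu> h) (i, j))"

definition row_equiv ::
    "nat \<Rightarrow> (nat \<Rightarrow> nat) \<Rightarrow> (nat \<Rightarrow> nat \<Rightarrow> nat) \<Rightarrow> ((box \<Rightarrow> nat) \<times> (box \<Rightarrow> nat)) set" where
  "row_equiv n m \<mu> =
     {(T, T'). T \<in> numberings n m \<mu> \<and> T' \<in> numberings n m \<mu> \<and>
        (\<forall>h\<in>{1..n}. \<forall>i\<ge>1. T ` row n \<mu> h i = T' ` row n \<mu> h i)}"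

definition tabloid ::
    "nat \<Rightarrow> (nat \<Rightarrow> nat) \<Rightarrow> (nat \<Rightarrow> nat \<Rightarrow> nat) \<Rightarrow> (box \<Rightarrow> nat) \<Rightarrow> (box \<Rightarrow> nat) set" where
  "tabloid n m \<mu> T = row_equiv n m \<mu> `` {T}"

definition tabloids ::
    "nat \<Rightarrow> (nat \<Rightarrow> nat) \<Rightarrow> (nat \<Rightarrow> nat \<Rightarrow> nat) \<Rightarrow> (box \<Rightarrow> nat) set set" where
  "tabloids n m \<mu> = numberings n m \<mu> // row_equiv n m \<mu>"

definition left_act ::
    "nat \<Rightarrow> (nat \<Rightarrow> nat \<Rightarrow> nat) \<Rightarrow> (nat \<Rightarrow> nat) \<Rightarrow> (box \<Rightarrow> nat) \<Rightarrow> box \<Rightarrow> nat" where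
  "left_act n \<mu> \<sigma> T = compose (boxes n \<mu>) \<sigma> T"

definition left_act_tabloid ::
    "nat \<Rightarrow> (nat \<Rightarrow> nat) \<Rightarrow> (nat \<Rightarrow> nat \<Rightarrow> nat) \<Rightarrow> (nat \<Rightarrow> nat) \<Rightarrow> (box \<Rightarrow> nat) set
      \<Rightarrow> (box \<Rightarrow> nat) set" where
  "left_act_tabloid n m \<mu> \<sigma> X = (\<Union>T\<in>X. tabloid n m \<mu> (left_act n \<mu> \<sigma> T))"

definition perm_of_numbering ::
    "nat \<Rightarrow> (nat \<Rightarrow> nat) \<Rightarrow> (nat \<Rightarrow> nat \<Rightarrow> nat) \<Rightarrow> (box \<Rightarrow> nat) \<Rightarrow> nat \<Rightarrow> nat" where
  "perm_of_numbering n m \<mu> T =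
     (THE \<tau>. \<tau> \<in> carrier (sym_group (\<Sum>h=1..n. m h)) \<and>
             T = compose (boxes n \<mu>) \<tau> (std_numbering n m \<mu>))"

definition right_act ::
    "nat \<Rightarrow> (nat \<Rightarrow> nat) \<Rightarrow> (nat \<Rightarrow> nat \<Rightarrow> nat) \<Rightarrow> (box \<Rightarrow> nat) \<Rightarrow> (nat \<Rightarrow> nat) \<Rightarrow> box \<Rightarrow> nat"
  where
  "right_act n m \<mu> T \<sigma> =
     compose (boxes n \<mu>) (perm_of_numbering n m \<mu> T \<circ> \<sigma>) (std_numbering n m \<mu>)"

text \<open>The union is a single class only for \<open>\<sigma>\<close> normalising the row stabiliser, as the powers
  of the element \<open>a_multi\<close> below do.\<close>

definition right_act_tabloid ::
    "nat \<Rightarrow> (nat \<Rightarrow> nat) \<Rightarrow> (nat \<Rightarrow> nat \<Rightarrow> nat) \<Rightarrow> (box \<Rightarrow> nat) set \<Rightarrow> (nat \<Rightarrow> nat)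
      \<Rightarrow> (box \<Rightarrow> nat) set" where
  "right_act_tabloid n m \<mu> X \<sigma> = (\<Union>T\<in>X. tabloid n m \<mu> (right_act n m \<mu> T \<sigma>))"

definition perm_prod :: "('a \<Rightarrow> 'a) list \<Rightarrow> 'a \<Rightarrow> 'a" where
  "perm_prod ps = foldr (\<circ>) ps id"

definition block_cycles :: "nat \<Rightarrow> (nat \<Rightarrow> nat) \<Rightarrow> (nat \<times> nat \<Rightarrow> nat) \<Rightarrow> (nat \<Rightarrow> nat) list" where
  "block_cycles l \<mu> t =
     [cycle_of_list [t (l * q + r, j). r \<leftarrow> [1..<l + 1]].
        q \<leftarrow> sorted_list_of_set {q. \<mu> (l * q + 1) \<noteq> 0}, j \<leftarrow> [1..<\<mu> (l * q + 1) + 1]]"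

definition a_single :: "(nat \<Rightarrow> nat) \<Rightarrow> nat \<Rightarrow> nat \<Rightarrow> nat" where
  "a_single \<mu> l = perm_prod (block_cycles l \<mu> (std_numbering1 \<mu>))"

definition a_multi ::
    "nat \<Rightarrow> (nat \<Rightarrow> nat) \<Rightarrow> (nat \<Rightarrow> nat \<Rightarrow> nat) \<Rightarrow> (nat \<Rightarrow> nat) \<Rightarrow> nat \<Rightarrow> nat" where
  "a_multi n m \<mu> l =
     perm_prod (concat [block_cycles (l h) (\<mu> h) (\<lambda>(i, j). std_numbering n m \<mu> (i, j, h)).
                          h \<leftarrow> [1..<n + 1]])"

definition fiber :: "nat \<Rightarrow> (nat \<Rightarrow> nat \<Rightarrow> nat) \<Rightarrow> (box \<Rightarrow> nat) \<Rightarrow> nat \<Rightarrow> box set" where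
  "fiber n \<mu> Y k = {b \<in> boxes n \<mu>. Y b = k}"

definition fiber_in :: "nat \<Rightarrow> (nat \<Rightarrow> nat \<Rightarrow> nat) \<Rightarrow> (box \<Rightarrow> nat) \<Rightarrow> nat \<Rightarrow> nat \<Rightarrow> bool" where
  "fiber_in n \<mu> Y k h \<longleftrightarrow> h \<in> {1..n} \<and> (\<forall>(i, j, h') \<in> fiber n \<mu> Y k. h' = h)"

text \<open>The offset \<open>(i', j')\<close> ranges over the integers: since \<open>s\<close> starts at 1, the tile
  containing row 1 has \<open>i' = 1 - l\<^sub>h / \<gamma>\<^sub>h\<close>, which is negative when \<open>\<gamma>\<^sub>h < l\<^sub>h\<close>.\<close>

definition rgl_tabloid ::
    "nat \<Rightarrow> (nat \<Rightarrow> nat \<Rightarrow> nat) \<Rightarrow> (nat \<Rightarrow> nat) \<Rightarrow> (nat \<Rightarrow> nat) \<Rightarrow> (nat \<Rightarrow> nat) \<Rightarrow> (box \<Rightarrow> nat) \<Rightarrow> bool"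
  where
  "rgl_tabloid n \<mu> \<rho> \<gamma> l Y \<longleftrightarrow>
     Y \<in> boxes n \<mu> \<rightarrow>\<^sub>E {1..} \<and>
     (\<forall>k\<ge>1. card (fiber n \<mu> Y k) = \<rho> k) \<and>
     (\<forall>k\<ge>1. \<exists>h\<in>{1..n}. \<exists>i' j' :: int. \<gamma> h dvd \<rho> k \<and>
        (\<lambda>(i, j, h). (int i, int j, h)) ` fiber n \<mu> Y k =
          {(int s * int (l h div \<gamma> h) + i', int t + j', h) | s t.
             1 \<le> s \<and> s \<le> \<gamma> h \<and> 1 \<le> t \<and> t \<le> \<rho> k div \<gamma> h}) \<and>
     (\<forall>i j k h. (i, j, h) \<in> boxes n \<mu> \<longrightarrow> (i, k, h) \<in> boxes n \<mu> \<longrightarrow> j \<le> k \<longrightarrow>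
        Y (i, j, h) \<le> Y (i, k, h))"

text \<open>An element of the coproduct of the \<open>\<int>/\<gamma>\<^sub>h\<int>\<close> is a pair \<open>(h, x)\<close> with the residue class
  represented by \<open>x \<in> {1..\<gamma>\<^sub>h}\<close>.\<close>

definition marked_rgl_tabloid ::
    "nat \<Rightarrow> (nat \<Rightarrow> nat \<Rightarrow> nat) \<Rightarrow> (nat \<Rightarrow> nat) \<Rightarrow> (nat \<Rightarrow> nat) \<Rightarrow> (nat \<Rightarrow> nat) \<Rightarrow> (box \<Rightarrow> nat)
      \<Rightarrow> (nat \<Rightarrow> nat \<times> nat) \<Rightarrow> bool" where
  "marked_rgl_tabloid n \<mu> \<rho> \<gamma> l Y c \<longleftrightarrow>
     rgl_tabloid n \<mu> \<rho> \<gamma> l Y \<and>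
     c \<in> {i. \<rho> i \<noteq> 0} \<rightarrow>\<^sub>E (SIGMA h:{1..n}. {1..\<gamma> h}) \<and>
     (\<forall>i h. \<rho> i \<noteq> 0 \<longrightarrow> fiber_in n \<mu> Y i h \<longrightarrow> fst (c i) = h)"

definition n_start :: "(nat \<Rightarrow> nat) \<Rightarrow> nat \<Rightarrow> nat" where
  "n_start \<rho> i = 1 + (\<Sum>k\<in>{1..<i}. \<rho> k)"

definition sigma_cycle :: "(nat \<Rightarrow> nat) \<Rightarrow> nat \<Rightarrow> nat \<Rightarrow> nat" where
  "sigma_cycle \<rho> i = cycle_of_list [n_start \<rho> i..<n_start \<rho> i + \<rho> i]"

definition sigma_perm :: "(nat \<Rightarrow> nat) \<Rightarrow> nat \<Rightarrow> nat" where
  "sigma_perm \<rho> = perm_prod (map (sigma_cycle \<rho>) (sorted_list_of_set {i. \<rho> i \<noteq> 0}))"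

definition has_cycle_type :: "nat \<Rightarrow> (nat \<Rightarrow> nat) \<Rightarrow> (nat \<Rightarrow> nat) \<Rightarrow> bool" where
  "has_cycle_type m \<sigma> \<rho> \<longleftrightarrow>
     partition_of \<rho> m \<and>
     image_mset card (mset_set (orbit \<sigma> ` {1..m})) = image_mset \<rho> (mset_set {i. \<rho> i \<noteq> 0})"

text \<open>\<open>shift_row l j\<close> sends row \<open>c + q l\<close>, \<open>1 \<le> c \<le> l\<close>, to row \<open>c' + q l\<close> with
  \<open>1 \<le> c' \<le> l\<close> and \<open>c'\<close> congruent to \<open>c - j\<close> modulo \<open>l\<close>.\<close>

definition shift_row :: "nat \<Rightarrow> int \<Rightarrow> nat \<Rightarrow> nat" where
  "shift_row l j r = ((r - 1) div l) * l + nat ((int (r - 1) - j) mod int l) + 1"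

text \<open>\<open>placed \<dots> N h i\<close>: the number \<open>N\<close> is put in row \<open>i\<close> of component \<open>h\<close>.\<close>

inductive placed ::
    "nat \<Rightarrow> (nat \<Rightarrow> nat \<Rightarrow> nat) \<Rightarrow> (nat \<Rightarrow> nat) \<Rightarrow> (nat \<Rightarrow> nat) \<Rightarrow> int \<Rightarrow> (box \<Rightarrow> nat)
      \<Rightarrow> (nat \<Rightarrow> nat \<times> nat) \<Rightarrow> nat \<Rightarrow> nat \<Rightarrow> nat \<Rightarrow> bool"
  for n \<mu> \<rho> l j Y c where
  start: "\<rho> k \<noteq> 0 \<Longrightarrow> fiber_in n \<mu> Y k h \<Longrightarrow>
    placed n \<mu> \<rho> l j Y c (n_start \<rho> k) h
      (sorted_list_of_set ((\<lambda>(i, j, h). i) ` fiber n \<mu> Y k) ! (snd (c k) - 1))"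
| step: "placed n \<mu> \<rho> l j Y c N h i \<Longrightarrow>
    placed n \<mu> \<rho> l j Y c (sigma_perm \<rho> N) h (shift_row (l h) j i)"

definition phi ::
    "nat \<Rightarrow> (nat \<Rightarrow> nat) \<Rightarrow> (nat \<Rightarrow> nat \<Rightarrow> nat) \<Rightarrow> (nat \<Rightarrow> nat) \<Rightarrow> (nat \<Rightarrow> nat) \<Rightarrow> int
      \<Rightarrow> (box \<Rightarrow> nat) \<Rightarrow> (nat \<Rightarrow> nat \<times> nat) \<Rightarrow> box \<Rightarrow> nat" where
  "phi n m \<mu> \<rho> l j Y c =
     (THE T. T \<in> numberings n m \<mu> \<and>
        (\<forall>h\<in>{1..n}. \<forall>i\<ge>1. T ` row n \<mu> h i = {N. placed n \<mu> \<rho> l j Y c N h i}) \<and>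
        (\<forall>i x y h. (i, x, h) \<in> boxes n \<mu> \<longrightarrow> (i, y, h) \<in> boxes n \<mu> \<longrightarrow> x < y \<longrightarrow>
           T (i, x, h) < T (i, y, h)))"

end

theory Submission
  imports Defs
begin

text \<open>
  A tabloid is a placement of the numbers \<open>1, \<dots>, M\<close> into rows. After conjugating by \<open>\<tau>\<close>, the fixed
  point equation says that whenever \<open>N\<close> lies in row \<open>i\<close> of component \<open>h\<close>, its image under \<open>\<sigma>\<^sub>\<rho>\<close>
  lies in the row shifted by \<open>- j\<close> within its block of \<open>l\<^sub>h\<close> rows. Hence the placement is determined
  by the component and the row of the first element of each cycle of \<open>\<sigma>\<^sub>\<rho>\<close>, and a cycle of length
  \<open>\<rho>\<^sub>k\<close> spreads evenly, \<open>\<rho>\<^sub>k / \<gamma>\<^sub>h\<close> numbers per row, over the \<open>\<gamma>\<^sub>h\<close> rows of a block in one residue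
  class modulo \<open>l\<^sub>h / \<gamma>\<^sub>h\<close>.

  Rows of one class therefore receive the same number of elements of every cycle. Numbering each row
  increasingly and replacing a number by the index of its cycle turns the cycles into rectangular
  tiles: this is \<open>Y\<close>, and \<open>c\<close> records the row of the first element of each cycle. Conversely, the
  tiles of \<open>Y\<close> have exactly the row counts that the cycles need.
\<close>

section \<open>Products of disjoint cycles and shifts of rows\<close>

text \<open>Everything about \<open>j\<close> and \<open>\<gamma>\<close> is condensed in one
  criterion: \<open>\<gamma> h\<close> divides \<open>d\<close> iff \<open>l h\<close> divides
  \<open>j * d\<close>. It forces \<open>l h div \<gamma> h\<close> to be the gcd of
  \<open>l h\<close> and \<open>j\<close>, so the residue classes of rows are the orbits of the
  shift by \<open>j\<close>, and it says that a cycle closes up after \<open>\<rho> k\<close> steps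
  iff \<open>\<gamma> h\<close> divides \<open>\<rho> k\<close>. Tiles come out rectangular because
  the cycles of the standard permutation are consecutive intervals of numbers: in an increasing row
  the entries of one cycle form a single run, whose first column depends only on how many entries
  the earlier cycles have there. Two obstacles shape the converse: \<open>phi\<close> is a definite
  description, about which nothing is known until the row counts are seen to match, and the tile
  condition by itself leaves room for tiles that straddle two blocks.\<close>

lemma cycle_of_list_nth:
  assumes "distinct cs" "k < length cs"
  shows "cycle_of_list cs (cs ! k) = cs ! (Suc k mod length cs)"
proof -
  have "map (cycle_of_list cs) cs = rotate1 cs"
    using cyclic_rotation[of cs 1] assms by simp
  then have "map (cycle_of_list cs) cs ! k = rotate1 cs ! k" by simp
  then show ?thesis using assms by (simp add: nth_rotate1)
qed

lemma perm_prod_cycles_outside: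
  assumes "\<And>a. a \<in> set as \<Longrightarrow> x \<notin> set (f a)"
  shows "perm_prod (map (\<lambda>a. cycle_of_list (f a)) as) x = x"
  using assms by (induction as) (auto simp: perm_prod_def id_outside_supp)

text \<open>Disjointness confines the action to one factor: the factors applied before it fix the
  point, those applied after it fix the image.\<close>

lemma perm_prod_cycles_nth:
  assumes "distinct as" "\<And>a. a \<in> set as \<Longrightarrow> distinct (f a)"
    and "\<And>a b. a \<in> set as \<Longrightarrow> b \<in> set as \<Longrightarrow> a \<noteq> b \<Longrightarrow> set (f a) \<inter> set (f b) = {}"
    and "a \<in> set as" "k < length (f a)"
  shows "perm_prod (map (\<lambda>a. cycle_of_list (f a)) as) (f a ! k) = f a ! (Suc k mod length (f a))"
  using assms
proof (induction as)
  case (Cons b bs)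
  have len: "Suc k mod length (f a) < length (f a)" using Cons.prems(5) by (intro mod_less_divisor) linarith
  have split: "perm_prod (map (\<lambda>a. cycle_of_list (f a)) (b # bs)) x =
      cycle_of_list (f b) (perm_prod (map (\<lambda>a. cycle_of_list (f a)) bs) x)" for x
    by (simp add: perm_prod_def)
  show ?case
  proof (cases "a = b")
    case True
    have "perm_prod (map (\<lambda>a. cycle_of_list (f a)) bs) (f a ! k) = f a ! k"
    proof (rule perm_prod_cycles_outside)
      fix c assume "c \<in> set bs"
      then have "set (f a) \<inter> set (f c) = {}" using Cons.prems(1) Cons.prems(3)[of a c] True by auto
      then show "f a ! k \<notin> set (f c)" using Cons.prems(5) nth_mem by blast
    qed
    then show ?thesis unfolding split using True Cons.prems cycle_of_list_nth[of "f a" k] by simp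
  next
    case False
    then have "perm_prod (map (\<lambda>a. cycle_of_list (f a)) bs) (f a ! k) = f a ! (Suc k mod length (f a))"
      using Cons by auto
    moreover have "f a ! (Suc k mod length (f a)) \<notin> set (f b)"
      using Cons.prems False len nth_mem
      by (metis disjoint_iff list.set_intros(1))
    ultimately show ?thesis unfolding split by (simp add: id_outside_supp)
  qed
qed auto

lemma perm_prod_cycles_permutes:
  assumes "\<And>a. a \<in> set as \<Longrightarrow> set (f a) \<subseteq> A"
  shows "perm_prod (map (\<lambda>a. cycle_of_list (f a)) as) permutes A"
  using assms
proof (induction as)
  case (Cons b bs)
  have "cycle_of_list (f b) permutes A"
    using cycle_permutes[of "f b"] Cons.prems[of b] permutes_subset by fastforce
  moreover have "perm_prod (map (\<lambda>a. cycle_of_list (f a)) bs) permutes A" using Cons by auto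
  ultimately show ?case using permutes_compose[of "perm_prod (map (\<lambda>a. cycle_of_list (f a)) bs)" A]
    by (simp add: perm_prod_def comp_def)
qed (simp add: perm_prod_def permutes_id)

lemma distinct_concat_Pair:
  assumes "distinct xs" "\<And>x. x \<in> set xs \<Longrightarrow> distinct (g x)"
  shows "distinct (concat (map (\<lambda>x. map (Pair x) (g x)) xs))"
  using assms by (induction xs) (auto simp: distinct_map inj_on_def)

text \<open>Segments of lengths \<open>f 1\<close>, ..., \<open>f K\<close> laid end to end. The
  same bijection serves the rows of a diagram, the components of \<open>\<mu>\<close> and the cycles
  of the standard permutation.\<close>

lemma stack_bij:
  fixes f :: "nat \<Rightarrow> nat"
  shows "bij_betw (\<lambda>(i, j). sum f {1..<i} + j) {(i, j). i \<in> {1..K} \<and> j \<in> {1..f i}} {1..sum f {1..K}}"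
proof (induction K)
  case 0
  then show ?case by (simp add: bij_betw_def)
next
  case (Suc K)
  let ?F = "\<lambda>(i, j). sum f {1..<i} + j"
  have e1: "{(i, j). i \<in> {1..Suc K} \<and> j \<in> {1..f i}} =
      {(i, j). i \<in> {1..K} \<and> j \<in> {1..f i}} \<union> {Suc K} \<times> {1..f (Suc K)}"
    by (auto simp: le_Suc_eq)
  have e2: "{1..sum f {1..Suc K}} = {1..sum f {1..K}} \<union> {sum f {1..K} + 1..sum f {1..K} + f (Suc K)}"
    by auto
  have "bij_betw ?F ({Suc K} \<times> {1..f (Suc K)}) {sum f {1..K} + 1..sum f {1..K} + f (Suc K)}"
    by (rule bij_betw_byWitness[where f' = "\<lambda>y. (Suc K, y - sum f {1..K})"])
      (auto simp: atLeastLessThanSuc_atLeastAtMost)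
  then show ?case unfolding e1 e2 by (intro bij_betw_combine[OF Suc.IH]) auto
qed

section \<open>Standard numbering of a partition and its blocks of equal rows\<close>

lemma partition_bound:
  assumes "partition_of \<mu> m"
  obtains K where "\<And>i. i > K \<Longrightarrow> \<mu> i = 0" "sum \<mu> {1..K} = m"
proof -
  have fin: "finite {i. \<mu> i \<noteq> 0}" and 0: "\<mu> 0 = 0" and s: "(\<Sum>i | \<mu> i \<noteq> 0. \<mu> i) = m"
    using assms by (auto simp: partition_of_def)
  obtain K where K: "\<forall>i\<in>{i. \<mu> i \<noteq> 0}. i \<le> K"
    using fin finite_nat_set_iff_bounded_le by blast
  \<comment> \<open>The range may start at 1 because of the dummy value
    \<open>\<mu> 0 = 0\<close>.\<close>
  have "(\<Sum>i | \<mu> i \<noteq> 0. \<mu> i) = sum \<mu> {1..K}"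
    using K 0 by (intro sum.mono_neutral_left) (auto simp: Suc_le_eq intro!: gr0I)
  then show ?thesis using that[of K] K s by force
qed

lemma std_numbering1_bij:
  assumes "partition_of \<mu> m"
  shows "bij_betw (std_numbering1 \<mu>) (diagram \<mu>) {1..m}"
proof -
  obtain K where K: "\<And>i. i > K \<Longrightarrow> \<mu> i = 0" "sum \<mu> {1..K} = m"
    using partition_bound[OF assms] by metis
  have D: "diagram \<mu> = {(i, j). i \<in> {1..K} \<and> j \<in> {1..\<mu> i}}"
    using K(1) by (force simp: diagram_def not_le[symmetric])
  have "bij_betw (\<lambda>(i, j). sum \<mu> {1..<i} + j) (diagram \<mu>) {1..m}"
    using stack_bij[of \<mu> K] K(2) D by simp
  then show ?thesis
    by (rule bij_betw_cong[THEN iffD1, rotated]) (auto simp: std_numbering1_def)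
qed

lemma down_closed_eq:
  fixes D :: "nat set"
  assumes "finite D" "0 \<notin> D" "\<And>a b. b \<in> D \<Longrightarrow> 1 \<le> a \<Longrightarrow> a \<le> b \<Longrightarrow> a \<in> D"
  shows "D = {1..card D}"
proof (cases "D = {}")
  case False
  then have mx: "Max D \<in> D" using assms(1) by simp
  have "D = {1..Max D}"
  proof (intro equalityI subsetI)
    fix a assume "a \<in> D"
    moreover from this have "a \<noteq> 0" using assms(2) by metis
    ultimately show "a \<in> {1..Max D}" using assms(1) by simp
  qed (use assms(3)[OF mx] in auto)
  then show ?thesis by (metis card_atLeastAtMost diff_Suc_1)
qed simp

text \<open>The rows of length at least \<open>v\<close> form an initial segment, and their number
  is a sum of multiplicities, each divisible by \<open>l\<close>. So the segment is a union of whole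
  blocks of \<open>l\<close> rows, and two rows of one block lie in it together.\<close>

lemma l_partition_block:
  assumes "l_partition_of l \<mu> m" "l > 0" "i \<ge> 1" "i' \<ge> 1" "(i - 1) div l = (i' - 1) div l"
  shows "\<mu> i = \<mu> i'"
proof -
  have p: "partition_of \<mu> m" and dv: "\<And>v. v \<ge> 1 \<Longrightarrow> l dvd card {k. k \<ge> 1 \<and> \<mu> k = v}"
    using assms by (auto simp: l_partition_of_def)
  have mono: "\<And>i k. 1 \<le> i \<Longrightarrow> i \<le> k \<Longrightarrow> \<mu> k \<le> \<mu> i" and fin: "finite {i. \<mu> i \<noteq> 0}"
    using p by (auto simp: partition_of_def)
  have le: "\<mu> i \<le> \<mu> i'" if i: "i \<ge> 1" "i' \<ge> 1" "(i - 1) div l = (i' - 1) div l" for i i'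
  proof (cases "\<mu> i = 0")
    case False
    define v where "v = \<mu> i"
    define S where "S = {k. k \<ge> 1 \<and> \<mu> k \<ge> v}"
    have v: "v \<ge> 1" using False v_def by simp
    have finS: "finite S" using fin v by (auto simp: S_def intro: finite_subset[rotated])
    have "card S = (\<Sum>y\<in>\<mu> ` S. card {k \<in> S. \<mu> k = y})"
      using sum.image_gen[OF finS, of "\<lambda>_. 1::nat" \<mu>] by simp
    moreover have "l dvd card {k \<in> S. \<mu> k = y}" if "y \<in> \<mu> ` S" for y
    proof -
      have "{k \<in> S. \<mu> k = y} = {k. k \<ge> 1 \<and> \<mu> k = y}" "y \<ge> 1" using that v by (auto simp: S_def)
      then show ?thesis using dv by simp
    qed
    ultimately have l: "l dvd card S" by (simp add: dvd_sum)
    have S: "S = {1..card S}"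
    proof (rule down_closed_eq)
      show "a \<in> S" if "b \<in> S" "1 \<le> a" "a \<le> b" for a b
        using that mono[of a b] by (auto simp: S_def)
    qed (use finS in \<open>auto simp: S_def\<close>)
    have "i \<in> S" using i v_def by (simp add: S_def)
    then have "i \<le> card S" using S by auto
    \<comment> \<open>As \<open>l\<close> divides \<open>card S\<close>, membership in
      \<open>S\<close> depends only on the block number.\<close>
    then have "(i - 1) div l < card S div l"
      using l assms(2) i by (metis One_nat_def Suc_diff_1 Suc_le_eq div_less_iff_less_mult dvd_div_mult_self)
    then have "(i' - 1) div l < card S div l" using i by simp
    then have "i' - 1 < card S" using l assms(2) by (metis div_less_iff_less_mult dvd_div_mult_self)
    then have "i' \<in> {1..card S}" using i by auto
    then have "i' \<in> S" using S by blast
    then show ?thesis by (simp add: S_def v_def)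
  qed simp
  show ?thesis using le[OF assms(3-5)] le[OF assms(4,3) assms(5)[symmetric]] by simp
qed

section \<open>Arithmetic of the row shift\<close>

lemma shift_row_pos: "shift_row l j i > 0"
  by (simp add: shift_row_def)

lemma shift_row_div:
  assumes "l > 0" shows "(shift_row l j i - Suc 0) div l = (i - Suc 0) div l"
proof -
  have "nat ((int (i - 1) - j) mod int l) < l"
    using assms by (simp add: nat_less_iff)
  then show ?thesis by (simp add: shift_row_def)
qed

lemma shift_row_mod:
  assumes "l > 0" shows "int ((shift_row l j i - Suc 0) mod l) = (int (i - Suc 0) - j) mod int l"
proof -
  have "nat ((int (i - 1) - j) mod int l) < l"
    using assms by (simp add: nat_less_iff)
  then show ?thesis using assms by (simp add: shift_row_def)
qed

lemma row_eqI:
  fixes i i' l :: nat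
  assumes "i > 0" "i' > 0" "(i - Suc 0) div l = (i' - Suc 0) div l"
    "(i - Suc 0) mod l = (i' - Suc 0) mod l"
  shows "i = i'"
proof -
  have "i - Suc 0 = i' - Suc 0" using assms(3,4) by (metis div_mult_mod_eq)
  then show ?thesis using assms by simp
qed

text \<open>Shifts form an action of the integers: the block number is kept and the position within
  the block is translated modulo \<open>l\<close>.\<close>

lemma shift_row_shift_row:
  assumes "l > 0" shows "shift_row l a (shift_row l b i) = shift_row l (a + b) i"
proof (rule row_eqI[where l = l])
  have "int ((shift_row l a (shift_row l b i) - Suc 0) mod l) =
      (int ((shift_row l b i - Suc 0) mod l) - a) mod int l"
    unfolding shift_row_mod[OF assms, of a] by (simp add: zmod_int mod_diff_left_eq)
  also have "\<dots> = int ((shift_row l (a + b) i - Suc 0) mod l)"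
    unfolding shift_row_mod[OF assms] by (simp add: mod_diff_left_eq algebra_simps)
  finally show "(shift_row l a (shift_row l b i) - Suc 0) mod l = (shift_row l (a + b) i - Suc 0) mod l"
    by linarith
qed (simp_all add: shift_row_pos shift_row_div assms)

lemma shift_row_eq_iff:
  assumes "l > 0" shows "shift_row l a i = shift_row l b i \<longleftrightarrow> int l dvd a - b"
proof -
  have "shift_row l a i = shift_row l b i \<longleftrightarrow>
      (shift_row l a i - Suc 0) mod l = (shift_row l b i - Suc 0) mod l"
    using row_eqI[of "shift_row l a i" "shift_row l b i" l]
    by (auto simp: shift_row_pos shift_row_div assms)
  also have "\<dots> \<longleftrightarrow> int ((shift_row l a i - Suc 0) mod l) = int ((shift_row l b i - Suc 0) mod l)"
    by linarith
  also have "\<dots> \<longleftrightarrow> int l dvd (int (i - Suc 0) - a) - (int (i - Suc 0) - b)"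
    unfolding shift_row_mod[OF assms] by (rule mod_eq_dvd_iff)
  also have "(int (i - Suc 0) - a) - (int (i - Suc 0) - b) = - (a - b)" by simp
  finally show ?thesis by (simp only: dvd_minus_iff)
qed

text \<open>Positivity matters: subtraction truncates, so row 0 would be sent to row 1.\<close>

lemma shift_row_0: "i > 0 \<Longrightarrow> shift_row l 0 i = i"
  by (cases i) (simp_all add: shift_row_def nat_mod_distrib)

lemma shift_row_eq_self_iff:
  assumes "l > 0" "i > 0" shows "shift_row l a i = i \<longleftrightarrow> int l dvd a"
  using shift_row_eq_iff[OF assms(1), of a i 0] shift_row_0[OF assms(2)] by simp

text \<open>One step of a block cycle goes down by one row, cyclically. As \<open>shift_row\<close>
  subtracts its argument, this is the shift by -1; here \<open>r\<close> counts from 0.\<close>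

lemma shift_row_minus_1:
  "shift_row l (-1) (l * q + r + 1) = l * q + Suc r mod l + 1" if "r < l"
proof -
  have "(int (l * q + r) + 1) mod int l = int (Suc r mod l)"
    by (metis add.commute mod_mult_self2 of_nat_Suc of_nat_add of_nat_mult zmod_int add_Suc_right plus_1_eq_Suc)
  then show ?thesis using that by (simp add: shift_row_def)
qed

lemma l_partition_shift_row:
  assumes "l_partition_of l \<mu> m" "l > 0" "i > 0"
  shows "\<mu> (shift_row l j i) = \<mu> i"
  using l_partition_block[OF assms(1,2), of "shift_row l j i" i] assms(2,3)
  by (simp add: shift_row_pos shift_row_div Suc_le_eq)

section \<open>Cycles of the block rotation, named by block and column\<close>

definition block_index :: "nat \<Rightarrow> (nat \<Rightarrow> nat) \<Rightarrow> (nat \<times> nat) list" where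
  "block_index l \<mu> = concat (map (\<lambda>q. map (Pair q) [1..<\<mu> (l * q + 1) + 1])
     (sorted_list_of_set {q. \<mu> (l * q + 1) \<noteq> 0}))"

lemma distinct_block_index: "distinct (block_index l \<mu>)"
  unfolding block_index_def by (rule distinct_concat_Pair) auto

text \<open>Finiteness of the set of \<open>q\<close> is the point, since
  \<open>sorted_list_of_set\<close> of an infinite set is \<open>[]\<close>. It follows from the
  finite support of \<open>\<mu>\<close>, as \<open>l > 0\<close> makes \<open>l * q + 1\<close>
  injective in \<open>q\<close>.\<close>

lemma set_block_index:
  assumes "partition_of \<mu> m" "l > 0"
  shows "set (block_index l \<mu>) = {(q, x). 1 \<le> x \<and> x \<le> \<mu> (l * q + 1)}"
proof -
  have "finite ((\<lambda>q. l * q + 1) -` {i. \<mu> i \<noteq> 0})"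
    using assms by (intro finite_vimageI) (auto simp: partition_of_def inj_on_def)
  then have "finite {q. \<mu> (l * q + 1) \<noteq> 0}" by (simp add: vimage_def)
  then show ?thesis by (auto simp: block_index_def image_iff simp del: upt_Suc)
qed

lemma block_cycles_eq:
  "block_cycles l \<mu> t =
     map (\<lambda>(q, x). cycle_of_list (map (\<lambda>r. t (l * q + r, x)) [1..<l + 1])) (block_index l \<mu>)"
  by (simp add: block_cycles_def block_index_def map_concat comp_def del: upt_Suc)

text \<open>A single step determines all integer powers of \<open>a\<close> on the labels
  \<open>s b\<close>, because \<open>f\<close> is an action of the integers on
  \<open>B\<close>.\<close>

lemma sym_group_pow_shift:
  fixes s :: "'b \<Rightarrow> nat" and f :: "int \<Rightarrow> 'b \<Rightarrow> 'b"
  assumes a: "a \<in> carrier (sym_group N)"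
    and B: "\<And>z b. b \<in> B \<Longrightarrow> f z b \<in> B"
    and f0: "\<And>b. b \<in> B \<Longrightarrow> f 0 b = b"
    and f: "\<And>y z b. b \<in> B \<Longrightarrow> f y (f z b) = f (y + z) b"
    and step: "\<And>b. b \<in> B \<Longrightarrow> a (s b) = s (f 1 b)"
    and b: "b \<in> B"
  shows "(a [^]\<^bsub>sym_group N\<^esub> (z :: int)) (s b) = s (f z b)"
proof -
  interpret group "sym_group N" by (rule sym_group_is_group)
  have add: "a [^]\<^bsub>sym_group N\<^esub> (y + z) = a [^]\<^bsub>sym_group N\<^esub> y \<circ> a [^]\<^bsub>sym_group N\<^esub> z" for y z :: int
    using int_pow_mult[OF a] by (simp add: sym_group_mult)
  have one: "a [^]\<^bsub>sym_group N\<^esub> (1 :: int) = a" using int_pow_1 a by simp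
  show ?thesis using b
  proof (induction z arbitrary: b rule: int_induct[where k = 0])
    case base
    then show ?case by (simp add: sym_group_one f0)
  next
    case (step1 z)
    have "(a [^]\<^bsub>sym_group N\<^esub> (z + 1)) (s b) = (a [^]\<^bsub>sym_group N\<^esub> z) (s (f 1 b))"
      using add[of z 1] one step step1.prems by simp
    then show ?case using step1.IH[OF B] f step1.prems by simp
  next
    case (step2 z)
    \<comment> \<open>Writing the label as an image under \<open>a\<close> turns the exponent
      \<open>z - 1\<close> into \<open>z\<close>, so no inverse permutation has to be
      computed.\<close>
    let ?b = "f (- 1) b"
    have b: "?b \<in> B" and sb: "s b = a (s ?b)" using step2.prems B step f f0 by simp_all
    have "(a [^]\<^bsub>sym_group N\<^esub> (z - 1)) (s b) = (a [^]\<^bsub>sym_group N\<^esub> z) (s ?b)"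
      using add[of "z - 1" 1] one sb by simp
    then show ?case using step2.IH[OF b] f[OF step2.prems] by simp
  qed
qed

section \<open>Numberings and the block rotation\<close>

locale multi_shape =
  fixes n :: nat and m l :: "nat \<Rightarrow> nat" and \<mu> :: "nat \<Rightarrow> nat \<Rightarrow> nat"
  assumes n_pos: "n \<ge> 1"
    and m_pos: "\<And>h. h \<in> {1..n} \<Longrightarrow> m h > 0"
    and l_pos: "\<And>h. h \<in> {1..n} \<Longrightarrow> l h > 0"
    and shape: "multi_l_partition_of n l \<mu> m"
begin

definition "box_count = (\<Sum>h=1..n. m h)"

lemma l_part: "h \<in> {1..n} \<Longrightarrow> l_partition_of (l h) (\<mu> h) (m h)"
  using shape by (simp add: multi_l_partition_of_def)

lemma part: "h \<in> {1..n} \<Longrightarrow> partition_of (\<mu> h) (m h)"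
  using l_part by (simp add: l_partition_of_def)

lemma mem_boxes: "(i, x, h) \<in> boxes n \<mu> \<longleftrightarrow> h \<in> {1..n} \<and> i > 0 \<and> 1 \<le> x \<and> x \<le> \<mu> h i"
  by (auto simp: boxes_def diagram_def)

lemma row_eq:
  assumes "h \<in> {1..n}" "i > 0"
  shows "row n \<mu> h i = (\<lambda>x. (i, x, h)) ` {1..\<mu> h i}"
  using assms by (auto simp: row_def mem_boxes)

lemma shape_shift_row:
  assumes "h \<in> {1..n}" "i > 0" shows "\<mu> h (shift_row (l h) j i) = \<mu> h i"
  by (rule l_partition_shift_row[OF l_part[OF assms(1)] l_pos[OF assms(1)] assms(2)])

lemma shift_box:
  assumes "(i, x, h) \<in> boxes n \<mu>" shows "(shift_row (l h) j i, x, h) \<in> boxes n \<mu>"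
proof -
  have "h \<in> {1..n}" "i > 0" using assms by (simp_all add: mem_boxes)
  then have "\<mu> h (shift_row (l h) j i) = \<mu> h i" by (rule shape_shift_row)
  then show ?thesis using assms by (simp add: mem_boxes shift_row_pos)
qed

lemma card_row: "h \<in> {1..n} \<Longrightarrow> i > 0 \<Longrightarrow> card (row n \<mu> h i) = \<mu> h i"
  by (simp add: row_eq card_image inj_on_def)

lemma numbering_bij: "T \<in> numberings n m \<mu> \<Longrightarrow> bij_betw T (boxes n \<mu>) {1..box_count}"
  by (simp add: numberings_def box_count_def)

lemma std_numbering_in: "std_numbering n m \<mu> \<in> numberings n m \<mu>"
proof -
  let ?F = "\<lambda>(i, x, h). (h, std_numbering1 (\<mu> h) (i, x))"
  have b1: "bij_betw ?F (boxes n \<mu>) {(h, y). h \<in> {1..n} \<and> y \<in> {1..m h}}"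
  proof -
    have b: "bij_betw (std_numbering1 (\<mu> h)) (diagram (\<mu> h)) {1..m h}" if "h \<in> {1..n}" for h
      using std_numbering1_bij[OF part[OF that]] .
    have "inj_on ?F (boxes n \<mu>)"
      using bij_betw_imp_inj_on[OF b] by (auto simp: inj_on_def boxes_def)
    moreover have "?F ` boxes n \<mu> = {(h, y). h \<in> {1..n} \<and> y \<in> {1..m h}}"
    proof (intro equalityI subsetI)
      fix p assume "p \<in> ?F ` boxes n \<mu>"
      then show "p \<in> {(h, y). h \<in> {1..n} \<and> y \<in> {1..m h}}"
        using bij_betw_imp_surj_on[OF b] by (fastforce simp: boxes_def)
    next
      fix p assume "p \<in> {(h, y). h \<in> {1..n} \<and> y \<in> {1..m h}}"
      then obtain h y where p: "p = (h, y)" "h \<in> {1..n}" "y \<in> {1..m h}" by auto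
      then obtain i x where "(i, x) \<in> diagram (\<mu> h)" "y = std_numbering1 (\<mu> h) (i, x)"
        using bij_betw_imp_surj_on[OF b[OF p(2)]] by (metis imageE surj_pair)
      then show "p \<in> ?F ` boxes n \<mu>"
        using p by (intro image_eqI[of _ _ "(i, x, h)"]) (auto simp: boxes_def)
    qed
    ultimately show ?thesis by (simp add: bij_betw_def)
  qed
  have "bij_betw ((\<lambda>(h, y). sum m {1..<h} + y) \<circ> ?F) (boxes n \<mu>) {1..sum m {1..n}}"
    using bij_betw_trans[OF b1 stack_bij] .
  then have "bij_betw (std_numbering n m \<mu>) (boxes n \<mu>) {1..sum m {1..n}}"
    by (rule bij_betw_cong[THEN iffD1, rotated]) (auto simp: std_numbering_def)
  then show ?thesis by (simp add: numberings_def std_numbering_def)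
qed

lemma compose_numbering:
  assumes "T \<in> numberings n m \<mu>" "p permutes {1..box_count}"
  shows "compose (boxes n \<mu>) p T \<in> numberings n m \<mu>"
proof -
  have "bij_betw (p \<circ> T) (boxes n \<mu>) {1..box_count}"
    using bij_betw_trans[OF numbering_bij[OF assms(1)] permutes_imp_bij[OF assms(2)]] .
  then have "bij_betw (compose (boxes n \<mu>) p T) (boxes n \<mu>) {1..box_count}"
    by (rule bij_betw_cong[THEN iffD1, rotated]) (simp add: compose_def)
  then show ?thesis by (simp add: numberings_def compose_extensional box_count_def)
qed

lemma perm_of_numbering:
  assumes T: "T \<in> numberings n m \<mu>"
  shows "perm_of_numbering n m \<mu> T permutes {1..box_count}"
    and "T = compose (boxes n \<mu>) (perm_of_numbering n m \<mu> T) (std_numbering n m \<mu>)"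
proof -
  let ?t = "std_numbering n m \<mu>" and ?B = "boxes n \<mu>"
  define P where "P = (\<lambda>\<tau>. \<tau> \<in> carrier (sym_group (\<Sum>h=1..n. m h)) \<and> T = compose ?B \<tau> ?t)"
  have t: "bij_betw ?t ?B {1..box_count}" using numbering_bij[OF std_numbering_in] .
  \<comment> \<open>The candidate is \<open>T\<close> after the inverse of the standard numbering,
    extended by the identity since members of \<open>sym_group\<close> move nothing outside the
    range.\<close>
  define \<tau> where "\<tau> = (\<lambda>y. if y \<in> {1..box_count} then T (inv_into ?B ?t y) else y)"
  have "bij_betw (T \<circ> inv_into ?B ?t) {1..box_count} {1..box_count}"
    using bij_betw_trans[OF bij_betw_inv_into[OF t] numbering_bij[OF T]] .
  then have "bij_betw \<tau> {1..box_count} {1..box_count}"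
    by (rule bij_betw_cong[THEN iffD1, rotated]) (simp add: \<tau>_def)
  then have \<tau>p: "\<tau> permutes {1..box_count}" by (rule bij_imp_permutes) (auto simp: \<tau>_def)
  have "T = compose ?B \<tau> ?t"
  proof (rule extensionalityI[of _ ?B])
    show "T \<in> extensional ?B" using T by (simp add: numberings_def)
    fix b assume b: "b \<in> ?B"
    then have "?t b \<in> {1..box_count}" using bij_betwE[OF t] by blast
    then show "T b = compose ?B \<tau> ?t b"
      using b by (simp add: compose_def \<tau>_def bij_betw_inv_into_left[OF t])
  qed simp
  then have P\<tau>: "P \<tau>" using \<tau>p by (simp add: P_def sym_group_carrier box_count_def)
  have uniq: "\<tau>' = \<tau>" if "P \<tau>'" for \<tau>'
  proof
    fix y
    have c: "compose ?B \<tau>' ?t = compose ?B \<tau> ?t" and p': "\<tau>' permutes {1..box_count}"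
      using that P\<tau> by (simp_all add: P_def sym_group_carrier box_count_def)
    show "\<tau>' y = \<tau> y"
    proof (cases "y \<in> {1..box_count}")
      case True
      then obtain b where "b \<in> ?B" "y = ?t b" 
        using bij_betw_imp_surj_on[OF t] by (metis imageE)
      then show ?thesis using fun_cong[OF c, of b] by (simp add: compose_def)
    next
      case False
      then show ?thesis using p' \<tau>p by (metis permutes_not_in)
    qed
  qed
  have "P (perm_of_numbering n m \<mu> T)"
    unfolding perm_of_numbering_def P_def[symmetric] using P\<tau> uniq by (rule theI)
  then show "perm_of_numbering n m \<mu> T permutes {1..box_count}"
    and "T = compose ?B (perm_of_numbering n m \<mu> T) ?t"
    by (simp_all add: P_def sym_group_carrier box_count_def)
qed

text \<open>Right multiplication permutes positions: \<open>T\<close> is a permutation after the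
  standard numbering, so \<open>p\<close> decides at which box \<open>T\<close> is read.\<close>

lemma right_act_eq:
  assumes T: "T \<in> numberings n m \<mu>" and b: "b \<in> boxes n \<mu>" "b' \<in> boxes n \<mu>"
    and p: "p (std_numbering n m \<mu> b) = std_numbering n m \<mu> b'"
  shows "right_act n m \<mu> T p b = T b'"
proof -
  have "T b' = perm_of_numbering n m \<mu> T (std_numbering n m \<mu> b')"
    using b perm_of_numbering(2)[OF T] by (metis compose_eq)
  then show ?thesis using b p by (simp add: right_act_def compose_def)
qed

lemma block_box:
  assumes "h \<in> {1..n}" "(q, x) \<in> set (block_index (l h) (\<mu> h))" "r \<in> {1..l h}"
  shows "(l h * q + r, x, h) \<in> boxes n \<mu>"
proof -
  have "\<mu> h (l h * q + r) = \<mu> h (l h * q + 1)"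
  proof (rule l_partition_block[OF l_part[OF assms(1)] l_pos[OF assms(1)]])
    show "(l h * q + r - 1) div l h = (l h * q + 1 - 1) div l h"
      using assms(3) by (cases r) auto
  qed (use assms(3) in auto)
  then show ?thesis
    using assms by (simp add: mem_boxes set_block_index[OF part[OF assms(1)] l_pos[OF assms(1)]])
qed

text \<open>The inverse reading of \<open>block_box\<close>, with \<open>r\<close> counted from 0
  instead of 1, as list positions are.\<close>

lemma box_block:
  assumes "(i, x, h) \<in> boxes n \<mu>"
  obtains q r where "i = l h * q + r + 1" "r < l h" "(q, x) \<in> set (block_index (l h) (\<mu> h))"
proof -
  define q r where "q = (i - 1) div l h" and "r = (i - 1) mod l h"
  have h: "h \<in> {1..n}" and i: "i > 0" using assms by (auto simp: mem_boxes)
  have "l h * q + r = i - 1" unfolding q_def r_def by (rule mult_div_mod_eq)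
  then have e: "i = l h * q + r + 1" using i by linarith
  have r: "r < l h" using l_pos[OF h] by (simp add: r_def)
  have "\<mu> h (l h * q + 1) = \<mu> h i"
    by (rule l_partition_block[OF l_part[OF h] l_pos[OF h]]) (use e r in simp_all)
  then have "(q, x) \<in> set (block_index (l h) (\<mu> h))"
    using assms h by (simp add: set_block_index[OF part[OF h] l_pos[OF h]] mem_boxes)
  with e r show ?thesis using that by blast
qed

definition "multi_index = concat (map (\<lambda>h. map (Pair h) (block_index (l h) (\<mu> h))) [1..<n + 1])"

abbreviation "multi_cycle \<equiv>
  (\<lambda>(h, q, x). map (\<lambda>r. std_numbering n m \<mu> (l h * q + r, x, h)) [1..<l h + 1])"

lemma a_multi_eq: "a_multi n m \<mu> l = perm_prod (map (\<lambda>a. cycle_of_list (multi_cycle a)) multi_index)"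
  unfolding a_multi_def block_cycles_eq multi_index_def
  by (simp add: map_concat comp_def del: upt_Suc) (simp add: case_prod_beta' del: upt_Suc)

lemma multi_index_mem:
  "(h, q, x) \<in> set multi_index \<longleftrightarrow> h \<in> {1..n} \<and> (q, x) \<in> set (block_index (l h) (\<mu> h))"
  by (auto simp: multi_index_def simp del: upt_Suc)

lemma std_numbering_inj: "inj_on (std_numbering n m \<mu>) (boxes n \<mu>)"
  using bij_betw_imp_inj_on[OF numbering_bij[OF std_numbering_in]] .

text \<open>Different indices give disjoint cycles, because the standard numbering is injective and
  a box determines its block and column. So only the cycle through the label acts on it.\<close>

lemma multi_cycle_step:
  assumes "(i, x, h) \<in> boxes n \<mu>"
  shows "a_multi n m \<mu> l (std_numbering n m \<mu> (i, x, h)) =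
    std_numbering n m \<mu> (shift_row (l h) (-1) i, x, h)"
proof -
  obtain q r where qr: "i = l h * q + r + 1" "r < l h" "(q, x) \<in> set (block_index (l h) (\<mu> h))"
    using box_block[OF assms] by metis
  have h: "h \<in> {1..n}" using assms by (simp add: mem_boxes)
  have nth: "multi_cycle (h, q, x) ! k = std_numbering n m \<mu> (l h * q + k + 1, x, h)" if "k < l h" for k
    using that by (simp del: upt_Suc)
  have dist: "distinct multi_index"
    unfolding multi_index_def by (rule distinct_concat_Pair) (simp_all add: distinct_block_index)
  have inj: "inj_on (std_numbering n m \<mu>) (boxes n \<mu>)" by (rule std_numbering_inj)
  have "perm_prod (map (\<lambda>a. cycle_of_list (multi_cycle a)) multi_index) (multi_cycle (h, q, x) ! r) =
      multi_cycle (h, q, x) ! (Suc r mod length (multi_cycle (h, q, x)))"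
  proof (rule perm_prod_cycles_nth[OF dist])
    fix a assume a: "a \<in> set multi_index"
    obtain h' q' x' where a': "a = (h', q', x')" by (metis prod_cases3)
    have "inj_on (\<lambda>r. std_numbering n m \<mu> (l h' * q' + r, x', h')) {1..l h'}"
    proof (rule inj_onI)
      fix r r' assume "r \<in> {1..l h'}" "r' \<in> {1..l h'}" and
        eq: "std_numbering n m \<mu> (l h' * q' + r, x', h') = std_numbering n m \<mu> (l h' * q' + r', x', h')"
      then show "r = r'"
        using inj_onD[OF inj eq] a a' block_box[of h' q' x'] by (simp add: multi_index_mem)
    qed
    then show "distinct (multi_cycle a)"
      unfolding a' by (simp add: distinct_map atLeastLessThanSuc_atLeastAtMost del: upt_Suc)
  next
    fix a b assume a: "a \<in> set multi_index" and b: "b \<in> set multi_index" and ab: "a \<noteq> b"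
    obtain h1 q1 x1 where e1: "a = (h1, q1, x1)" by (metis prod_cases3)
    obtain h2 q2 x2 where e2: "b = (h2, q2, x2)" by (metis prod_cases3)
    note e = e1 e2
    show "set (multi_cycle a) \<inter> set (multi_cycle b) = {}"
    proof (rule ccontr)
      assume "set (multi_cycle a) \<inter> set (multi_cycle b) \<noteq> {}"
      then obtain r1 r2 where r: "r1 \<in> {1..l h1}" "r2 \<in> {1..l h2}"
        "std_numbering n m \<mu> (l h1 * q1 + r1, x1, h1) = std_numbering n m \<mu> (l h2 * q2 + r2, x2, h2)"
        using e by (fastforce simp: atLeastLessThanSuc_atLeastAtMost simp del: upt_Suc)
      then have eq: "l h1 * q1 + r1 = l h2 * q2 + r2" "x1 = x2" "h1 = h2"
        using inj_onD[OF inj r(3)] block_box[of h1 q1 x1 r1] block_box[of h2 q2 x2 r2] a b r(1,2)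
        unfolding e multi_index_mem by blast+
      \<comment> \<open>Offsets run through 1, ..., \<open>l h1\<close>, so one is subtracted before
        the block number is read off by division.\<close>
      have "q1 = (l h1 * q1 + (r1 - 1)) div l h1" "q2 = (l h2 * q2 + (r2 - 1)) div l h2"
        using r(1,2) by (cases r1; cases r2; simp)+
      moreover have "l h1 * q1 + (r1 - 1) = l h2 * q2 + (r2 - 1)" using eq r by auto
      ultimately have "q1 = q2" using eq by metis
      then show False using ab e eq by simp
    qed
  qed (use h qr in \<open>simp_all add: multi_index_mem\<close>)
  then show ?thesis
    using qr nth[of r] nth[of "Suc r mod l h"] shift_row_minus_1[OF qr(2)]
    by (simp add: a_multi_eq del: upt_Suc)
qed

lemma a_multi_permutes: "a_multi n m \<mu> l permutes {1..box_count}"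
  unfolding a_multi_eq
proof (rule perm_prod_cycles_permutes)
  fix a assume a: "a \<in> set multi_index"
  obtain h q x where e: "a = (h, q, x)" by (metis prod_cases3)
  show "set (multi_cycle a) \<subseteq> {1..box_count}"
    using a e block_box[of h q x] bij_betwE[OF numbering_bij[OF std_numbering_in]]
    by (auto simp: multi_index_mem simp del: upt_Suc)
qed

text \<open>The rotation moves down while \<open>shift_row\<close> moves up, which accounts for the
  sign.\<close>

lemma a_multi_pow:
  assumes "(i, x, h) \<in> boxes n \<mu>"
  shows "(a_multi n m \<mu> l [^]\<^bsub>sym_group box_count\<^esub> (z :: int)) (std_numbering n m \<mu> (i, x, h)) =
    std_numbering n m \<mu> (shift_row (l h) (- z) i, x, h)"
proof -
  let ?f = "\<lambda>z :: int. \<lambda>(i, x, h). (shift_row (l h) (- z) i, x, h)"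
  have "(a_multi n m \<mu> l [^]\<^bsub>sym_group box_count\<^esub> z) (std_numbering n m \<mu> (i, x, h)) =
    std_numbering n m \<mu> (?f z (i, x, h))"
  proof (rule sym_group_pow_shift[where f = ?f and B = "boxes n \<mu>"])
    show "a_multi n m \<mu> l \<in> carrier (sym_group box_count)"
      using a_multi_permutes by (simp add: sym_group_carrier)
    show "?f z b \<in> boxes n \<mu>" if "b \<in> boxes n \<mu>" for z b
      using that shift_box by (cases b) auto
    show "?f 0 b = b" if "b \<in> boxes n \<mu>" for b
      using that by (cases b) (auto simp: mem_boxes shift_row_0)
    show "?f y (?f z b) = ?f (y + z) b" if "b \<in> boxes n \<mu>" for y z b
      using that by (cases b) (simp add: mem_boxes shift_row_shift_row l_pos)
    show "a_multi n m \<mu> l (std_numbering n m \<mu> b) = std_numbering n m \<mu> (?f 1 b)"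
      if "b \<in> boxes n \<mu>" for b
      using that multi_cycle_step by (cases b) auto
  qed (rule assms)
  then show ?thesis by simp
qed

end

section \<open>Actions on tabloids\<close>

text \<open>It makes the results for tuples available for one component, in order to compute the
  order of its rotation.\<close>

lemma a_single_eq_a_multi: "a_single \<mu> l = a_multi 1 (\<lambda>_. m) (\<lambda>_. \<mu>) (\<lambda>_. l)"
proof -
  have "(\<lambda>(i, j). std_numbering 1 (\<lambda>_. m) (\<lambda>_. \<mu>) (i, j, 1)) = std_numbering1 \<mu>"
    by (auto simp: std_numbering_def std_numbering1_def boxes_def fun_eq_iff)
  then show ?thesis by (simp add: a_single_def a_multi_def)
qed

text \<open>A power of the rotation is trivial iff \<open>l\<close> divides its exponent: the box in
  row 1 and column 1, present as \<open>m > 0\<close>, is fixed only then. The order is described by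
  what it divides, which is how it enters the counts.\<close>

lemma ord_a_single_pow_dvd_iff:
  assumes "l_partition_of l \<mu> m" "l > 0" "m > 0"
  shows "group.ord (sym_group m) (a_single \<mu> l [^]\<^bsub>sym_group m\<^esub> (j :: int)) dvd d \<longleftrightarrow>
    int l dvd j * int d"
proof -
  interpret multi_shape 1 "\<lambda>_. m" "\<lambda>_. l" "\<lambda>_. \<mu>"
    by unfold_locales (use assms in \<open>auto simp: multi_l_partition_of_def\<close>)
  have bc: "box_count = m" unfolding box_count_def by simp
  interpret G: group "sym_group m" by (rule sym_group_is_group)
  let ?a = "a_single \<mu> l" and ?t = "std_numbering 1 (\<lambda>_. m) (\<lambda>_. \<mu>)"
  have a: "?a \<in> carrier (sym_group m)"
    using a_multi_permutes unfolding bc sym_group_carrier a_single_eq_a_multi[where m = m] .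
  have pow: "(?a [^]\<^bsub>sym_group m\<^esub> z) (?t (i, x, h)) = ?t (shift_row l (- z) i, x, h)"
    if "(i, x, h) \<in> boxes 1 (\<lambda>_. \<mu>)" for z :: int and i x h
    using a_multi_pow[OF that] unfolding bc a_single_eq_a_multi[where m = m] .
  have "?a [^]\<^bsub>sym_group m\<^esub> z = id \<longleftrightarrow> int l dvd z" for z :: int
  proof
    assume id: "?a [^]\<^bsub>sym_group m\<^esub> z = id"
    have p: "partition_of \<mu> m" using assms by (simp add: l_partition_of_def)
    have "\<mu> 1 \<noteq> 0"
    proof
      assume 1: "\<mu> 1 = 0"
      have "\<mu> i = 0" for i
        using p 1 by (cases "i = 0") (force simp: partition_of_def)+
      then show False using p assms(3) by (simp add: partition_of_def)
    qed
    then have b: "(1, 1, 1) \<in> boxes 1 (\<lambda>_. \<mu>)" by (simp add: boxes_def diagram_def)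
    have "?t (shift_row l (- z) 1, 1, 1) = ?t (1, 1, 1)" using pow[OF b, of z] unfolding id by (simp only: id_apply)
    then have "shift_row l (- z) 1 = 1"
      using inj_onD[OF std_numbering_inj] b shift_box[OF b] by blast
    then show "int l dvd z" using shift_row_eq_self_iff[OF assms(2), of 1 "- z"] by simp
  next
    assume dv: "int l dvd z"
    show "?a [^]\<^bsub>sym_group m\<^esub> z = id"
    proof
      fix y
      have p: "?a [^]\<^bsub>sym_group m\<^esub> z permutes {1..m}"
        using G.int_pow_closed[OF a] by (simp add: sym_group_carrier)
      show "(?a [^]\<^bsub>sym_group m\<^esub> z) y = id y"
      proof (cases "y \<in> {1..m}")
        case True
        then have "y \<in> ?t ` boxes 1 (\<lambda>_. \<mu>)"
          using bij_betw_imp_surj_on[OF numbering_bij[OF std_numbering_in]] unfolding bc by (simp only:)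
        then obtain i x h where b: "(i, x, h) \<in> boxes 1 (\<lambda>_. \<mu>)" "y = ?t (i, x, h)"
          by auto
        then have "i > 0" by (simp only: mem_boxes)
        then have "shift_row l (- z) i = i" using shift_row_eq_self_iff[OF assms(2), of i "- z"] dv by simp
        then show ?thesis unfolding b(2) pow[OF b(1)] by simp
      next
        case False
        then show ?thesis using permutes_not_in[OF p] by simp
      qed
    qed
  qed
  moreover have "(?a [^]\<^bsub>sym_group m\<^esub> j) [^]\<^bsub>sym_group m\<^esub> d = ?a [^]\<^bsub>sym_group m\<^esub> (j * int d)"
    using G.int_pow_pow[OF a, of j "int d"] by (simp only: int_pow_int)
  ultimately show ?thesis
    using G.pow_eq_id[OF G.int_pow_closed[OF a], of j d] by (simp add: sym_group_one)
qed

lemma sorted_list_of_set_eq_map: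
  fixes f :: "nat \<Rightarrow> nat"
  assumes "\<And>x y. 1 \<le> x \<Longrightarrow> x < y \<Longrightarrow> y \<le> L \<Longrightarrow> f x < f y"
  shows "sorted_list_of_set (f ` {1..L}) = map f [1..<L + 1]"
proof -
  have "sorted_wrt (<) (map f [1..<L + 1])"
    unfolding sorted_wrt_map sorted_wrt_iff_nth_less using assms by (auto simp del: upt_Suc)
  moreover have "f ` {1..L} = set (map f [1..<L + 1])"
    by (simp add: atLeastLessThanSuc_atLeastAtMost del: upt_Suc)
  ultimately show ?thesis
    by (simp only: sorted_list_of_set.idem_if_sorted_distinct strict_sorted_iff)
qed

context multi_shape
begin

section \<open>Both actions in terms of row contents\<close>

lemma left_act_numbering:
  "T \<in> numberings n m \<mu> \<Longrightarrow> p permutes {1..box_count} \<Longrightarrow> left_act n \<mu> p T \<in> numberings n m \<mu>"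
  by (simp add: left_act_def compose_numbering)

lemma left_act_row: "left_act n \<mu> p T ` row n \<mu> h i = p ` T ` row n \<mu> h i"
proof -
  have "row n \<mu> h i \<subseteq> boxes n \<mu>" by (auto simp: row_def)
  then show ?thesis by (force simp: left_act_def compose_def)
qed

lemma right_act_numbering:
  "T \<in> numberings n m \<mu> \<Longrightarrow> p permutes {1..box_count} \<Longrightarrow> right_act n m \<mu> T p \<in> numberings n m \<mu>"
  unfolding right_act_def
  by (intro compose_numbering std_numbering_in permutes_compose perm_of_numbering(1))

lemma a_pow_permutes: "a_multi n m \<mu> l [^]\<^bsub>sym_group box_count\<^esub> (z :: int) permutes {1..box_count}"
  using group.int_pow_closed[OF sym_group_is_group] a_multi_permutes by (metis sym_group_carrier)

lemma right_act_a_numbering: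
  "T \<in> numberings n m \<mu> \<Longrightarrow>
    right_act n m \<mu> T (a_multi n m \<mu> l [^]\<^bsub>sym_group box_count\<^esub> (z :: int)) \<in> numberings n m \<mu>"
  by (intro right_act_numbering a_pow_permutes)

text \<open>The exponent \<open>- j\<close> becomes a shift by \<open>j\<close>. Rows of one block
  have equal length, so the columns correspond one to one.\<close>

lemma right_act_row:
  assumes "T \<in> numberings n m \<mu>" "h \<in> {1..n}" "i > 0"
  shows "right_act n m \<mu> T (a_multi n m \<mu> l [^]\<^bsub>sym_group box_count\<^esub> (- j)) ` row n \<mu> h i =
    T ` row n \<mu> h (shift_row (l h) j i)"
proof -
  have "right_act n m \<mu> T (a_multi n m \<mu> l [^]\<^bsub>sym_group box_count\<^esub> (- j)) (i, x, h) =
      T (shift_row (l h) j i, x, h)" if "x \<in> {1..\<mu> h i}" for x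
  proof -
    have b: "(i, x, h) \<in> boxes n \<mu>" using assms that by (simp add: mem_boxes)
    show ?thesis
      by (rule right_act_eq[OF assms(1) b shift_box[OF b]]) (simp add: a_multi_pow[OF b])
  qed
  then have "(\<lambda>x. right_act n m \<mu> T (a_multi n m \<mu> l [^]\<^bsub>sym_group box_count\<^esub> (- j)) (i, x, h)) ` {1..\<mu> h i} =
      (\<lambda>x. T (shift_row (l h) j i, x, h)) ` {1..\<mu> h i}" by (rule image_cong[OF refl])
  then show ?thesis
    using assms by (simp add: row_eq shift_row_pos shape_shift_row image_image)
qed

lemma mem_tabloid:
  "T' \<in> tabloid n m \<mu> T \<longleftrightarrow> T \<in> numberings n m \<mu> \<and> T' \<in> numberings n m \<mu> \<and>
    (\<forall>h\<in>{1..n}. \<forall>i>0. T ` row n \<mu> h i = T' ` row n \<mu> h i)"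
  by (auto simp: tabloid_def row_equiv_def Suc_le_eq)

lemma tabloid_eq_iff:
  assumes "T \<in> numberings n m \<mu>" "T' \<in> numberings n m \<mu>"
  shows "tabloid n m \<mu> T = tabloid n m \<mu> T' \<longleftrightarrow>
    (\<forall>h\<in>{1..n}. \<forall>i>0. T ` row n \<mu> h i = T' ` row n \<mu> h i)"
proof
  assume "tabloid n m \<mu> T = tabloid n m \<mu> T'"
  moreover have "T' \<in> tabloid n m \<mu> T'" using assms by (simp add: mem_tabloid)
  ultimately show "\<forall>h\<in>{1..n}. \<forall>i>0. T ` row n \<mu> h i = T' ` row n \<mu> h i" by (metis mem_tabloid)
qed (use assms in \<open>auto simp: set_eq_iff mem_tabloid\<close>)

lemma tabloids_eq: "tabloids n m \<mu> = tabloid n m \<mu> ` numberings n m \<mu>"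
  by (auto simp: tabloids_def quotient_def tabloid_def)

text \<open>The actions on tabloids are defined as unions over representatives; such a union
  collapses to one class as soon as the operation respects row equivalence.\<close>

lemma UN_tabloid_class:
  assumes "T \<in> numberings n m \<mu>" "\<And>T'. T' \<in> tabloid n m \<mu> T \<Longrightarrow> tabloid n m \<mu> (F T') = tabloid n m \<mu> (F T)"
  shows "(\<Union>T'\<in>tabloid n m \<mu> T. tabloid n m \<mu> (F T')) = tabloid n m \<mu> (F T)"
proof -
  have "T \<in> tabloid n m \<mu> T" using assms(1) by (simp add: mem_tabloid)
  then show ?thesis using assms(2) by blast
qed

lemma left_act_tabloid:
  assumes "T \<in> numberings n m \<mu>" "p permutes {1..box_count}"
  shows "left_act_tabloid n m \<mu> p (tabloid n m \<mu> T) = tabloid n m \<mu> (left_act n \<mu> p T)"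
  unfolding left_act_tabloid_def
proof (rule UN_tabloid_class[OF assms(1)])
  fix T' assume "T' \<in> tabloid n m \<mu> T"
  then show "tabloid n m \<mu> (left_act n \<mu> p T') = tabloid n m \<mu> (left_act n \<mu> p T)"
    using assms by (subst tabloid_eq_iff) (auto simp: mem_tabloid left_act_numbering left_act_row)
qed

lemma right_act_tabloid:
  fixes j :: int
  assumes "T \<in> numberings n m \<mu>"
  defines "a \<equiv> a_multi n m \<mu> l [^]\<^bsub>sym_group box_count\<^esub> (- j)"
  shows "right_act_tabloid n m \<mu> (tabloid n m \<mu> T) a = tabloid n m \<mu> (right_act n m \<mu> T a)"
  unfolding right_act_tabloid_def a_def
proof (rule UN_tabloid_class[OF assms(1)])
  fix T' assume "T' \<in> tabloid n m \<mu> T"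
  then show "tabloid n m \<mu> (right_act n m \<mu> T' (a_multi n m \<mu> l [^]\<^bsub>sym_group box_count\<^esub> (- j))) =
      tabloid n m \<mu> (right_act n m \<mu> T (a_multi n m \<mu> l [^]\<^bsub>sym_group box_count\<^esub> (- j)))"
    using assms
    by (subst tabloid_eq_iff)
      (auto simp: mem_tabloid right_act_a_numbering right_act_row shift_row_pos)
qed

lemma tabloid_fixed_iff:
  assumes "T \<in> numberings n m \<mu>" "p permutes {1..box_count}"
  shows "left_act_tabloid n m \<mu> p (tabloid n m \<mu> T) =
      right_act_tabloid n m \<mu> (tabloid n m \<mu> T) (a_multi n m \<mu> l [^]\<^bsub>sym_group box_count\<^esub> (- j)) \<longleftrightarrow>
    (\<forall>h\<in>{1..n}. \<forall>i>0. p ` T ` row n \<mu> h i = T ` row n \<mu> h (shift_row (l h) j i))"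
  using assms
  by (simp add: left_act_tabloid right_act_tabloid tabloid_eq_iff left_act_numbering
      right_act_a_numbering left_act_row right_act_row)

text \<open>The description inside \<open>phi\<close> with the row contents abstracted to
  \<open>S\<close>, so that it applies both to the placement rules and to the rows of a given
  numbering.\<close>

definition increasing_with_rows :: "(nat \<Rightarrow> nat \<Rightarrow> nat set) \<Rightarrow> (box \<Rightarrow> nat) \<Rightarrow> bool" where
  "increasing_with_rows S T \<longleftrightarrow> T \<in> numberings n m \<mu> \<and>
        (\<forall>h\<in>{1..n}. \<forall>i\<ge>1. T ` row n \<mu> h i = S h i) \<and>
        (\<forall>i x y h. (i, x, h) \<in> boxes n \<mu> \<longrightarrow> (i, y, h) \<in> boxes n \<mu> \<longrightarrow> x < y \<longrightarrow>
           T (i, x, h) < T (i, y, h))"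

text \<open>Read from left to right, a row is the sorted list of its prescribed entries.\<close>

lemma increasing_with_rows_unique:
  assumes "increasing_with_rows S T" "increasing_with_rows S T'"
  shows "T = T'"
proof (rule extensionalityI[of _ "boxes n \<mu>"])
  show "T \<in> extensional (boxes n \<mu>)" "T' \<in> extensional (boxes n \<mu>)"
    using assms by (simp_all add: increasing_with_rows_def numberings_def)
  fix b assume b: "b \<in> boxes n \<mu>"
  obtain i x h where e: "b = (i, x, h)" by (metis prod_cases3)
  have x: "h \<in> {1..n}" "i > 0" "x \<in> {1..\<mu> h i}" using b e by (auto simp: mem_boxes)
  have eq: "sorted_list_of_set (S h i) = map (\<lambda>x. T (i, x, h)) [1..<\<mu> h i + 1]"
    if "increasing_with_rows S T" for T
  proof -
    have "T ` row n \<mu> h i = S h i" using that x(1,2) by (simp add: increasing_with_rows_def)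
    then have "S h i = (\<lambda>x. T (i, x, h)) ` {1..\<mu> h i}"
      unfolding row_eq[OF x(1,2)] by (simp add: image_image)
    moreover have "T (i, x, h) < T (i, y, h)" if "1 \<le> x" "x < y" "y \<le> \<mu> h i" for x y
      using that \<open>increasing_with_rows S T\<close> x by (auto simp: increasing_with_rows_def mem_boxes)
    ultimately show ?thesis by (simp only: sorted_list_of_set_eq_map)
  qed
  have "map (\<lambda>x. T (i, x, h)) [1..<\<mu> h i + 1] ! (x - 1) = map (\<lambda>x. T' (i, x, h)) [1..<\<mu> h i + 1] ! (x - 1)"
    unfolding eq[OF assms(1), symmetric] eq[OF assms(2), symmetric] by (rule refl)
  then show "T b = T' b" using x e by (cases x) (auto simp del: upt_Suc)
qed

text \<open>Each row is filled with the sorted list of its set. The cardinalities make the lists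
  fit, disjointness separates the rows, and the cover gives surjectivity.\<close>

lemma increasing_with_rows_exists:
  assumes card: "\<And>h i. h \<in> {1..n} \<Longrightarrow> i > 0 \<Longrightarrow> finite (S h i) \<and> card (S h i) = \<mu> h i"
    and disj: "\<And>N h i h' i'. N \<in> S h i \<Longrightarrow> N \<in> S h' i' \<Longrightarrow> h = h' \<and> i = i'"
    and cover: "(\<Union>h\<in>{1..n}. \<Union>i\<in>{0<..}. S h i) = {1..box_count}"
  shows "\<exists>T. increasing_with_rows S T"
proof -
  \<comment> \<open>Columns count from 1, list positions from 0.\<close>
  define T where "T = (\<lambda>(i, x, h)\<in>boxes n \<mu>. sorted_list_of_set (S h i) ! (x - 1))"
  have T: "T (i, x, h) = sorted_list_of_set (S h i) ! (x - 1)" if "(i, x, h) \<in> boxes n \<mu>" for i x h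
    using that by (simp add: T_def)
  have len: "length (sorted_list_of_set (S h i)) = \<mu> h i" if "h \<in> {1..n}" "i > 0" for h i
    using card[OF that] by simp
  have rows: "T ` row n \<mu> h i = S h i" if hi: "h \<in> {1..n}" "i > 0" for h i
  proof -
    have "T ` row n \<mu> h i = (\<lambda>x. sorted_list_of_set (S h i) ! (x - 1)) ` {1..\<mu> h i}"
      using hi by (auto simp: row_eq image_image T mem_boxes intro!: image_cong)
    also have "\<dots> = (\<lambda>x. sorted_list_of_set (S h i) ! x) ` (\<lambda>x. x - 1) ` {1..\<mu> h i}"
      by (simp add: image_image)
    also have "(\<lambda>x. x - 1) ` {1..\<mu> h i} = {0..<\<mu> h i}"
      by (force simp: image_iff intro: bexI[of _ "Suc _"])
    also have "(\<lambda>x. sorted_list_of_set (S h i) ! x) ` {0..<\<mu> h i} = S h i"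
      using card[OF hi] len[OF hi] 
      by (metis list.set_map map_nth set_sorted_list_of_set set_upt)
    finally show ?thesis .
  qed
  have less: "T (i, x, h) < T (i, y, h)"
    if "(i, x, h) \<in> boxes n \<mu>" "(i, y, h) \<in> boxes n \<mu>" "x < y" for i x y h
    using that len[of h i] sorted_wrt_nth_less[OF strict_sorted_list_of_set, of "x - 1" "y - 1" "S h i"]
    by (auto simp: T mem_boxes)
  have inj: "inj_on T (boxes n \<mu>)"
  proof (rule inj_onI)
    fix b b' assume b: "b \<in> boxes n \<mu>" "b' \<in> boxes n \<mu>" and eq: "T b = T b'"
    obtain i x h where e: "b = (i, x, h)" by (metis prod_cases3)
    obtain i' x' h' where e': "b' = (i', x', h')" by (metis prod_cases3)
    have "T b \<in> S h i" "T b' \<in> S h' i'"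
      using b rows[of h i] rows[of h' i'] unfolding e e' by (force simp: row_def mem_boxes)+
    then have "h = h' \<and> i = i'" using disj eq by metis
    then show "b = b'"
      using less[of i x h x'] less[of i x' h x] b eq unfolding e e' by (metis less_irrefl linorder_neqE_nat)
  qed
  have "boxes n \<mu> = (\<Union>h\<in>{1..n}. \<Union>i\<in>{0<..}. row n \<mu> h i)"
    by (force simp: row_def mem_boxes)
  then have "T ` boxes n \<mu> = (\<Union>h\<in>{1..n}. \<Union>i\<in>{0<..}. S h i)"
    by (simp add: image_UN rows)
  then have "bij_betw T (boxes n \<mu>) {1..box_count}"
    using inj cover by (simp add: bij_betw_def)
  then have "T \<in> numberings n m \<mu>" by (simp add: numberings_def box_count_def T_def)
  then have "increasing_with_rows S T"
    using rows less by (auto simp: increasing_with_rows_def)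
  then show ?thesis by blast
qed

lemma phi_eq:
  assumes "increasing_with_rows (\<lambda>h i. {N. placed n \<mu> \<rho> l j Y c N h i}) T"
  shows "phi n m \<mu> \<rho> l j Y c = T"
proof -
  have "phi n m \<mu> \<rho> l j Y c = (THE T. increasing_with_rows (\<lambda>h i. {N. placed n \<mu> \<rho> l j Y c N h i}) T)"
    by (simp only: phi_def increasing_with_rows_def)
  also have "\<dots> = T" by (rule the_equality, rule assms, rule increasing_with_rows_unique[OF _ assms])
  finally show ?thesis .
qed

lemma numbering_row_cover:
  assumes "T \<in> numberings n m \<mu>"
  shows "(\<Union>h\<in>{1..n}. \<Union>i\<in>{0<..}. T ` row n \<mu> h i) = {1..box_count}"
proof -
  have "boxes n \<mu> = (\<Union>h\<in>{1..n}. \<Union>i\<in>{0<..}. row n \<mu> h i)"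
    by (force simp: row_def mem_boxes)
  then have "T ` boxes n \<mu> = (\<Union>h\<in>{1..n}. \<Union>i\<in>{0<..}. T ` row n \<mu> h i)" by (simp add: image_UN)
  then show ?thesis using bij_betw_imp_surj_on[OF numbering_bij[OF assms]] by simp
qed

lemma numbering_row_disjoint:
  assumes "T \<in> numberings n m \<mu>" "N \<in> T ` row n \<mu> h i" "N \<in> T ` row n \<mu> h' i'"
  shows "h = h' \<and> i = i'"
proof -
  obtain b b' where "b \<in> row n \<mu> h i" "b' \<in> row n \<mu> h' i'" "T b = T b'" using assms by auto
  moreover have "row n \<mu> h i \<subseteq> boxes n \<mu>" for h i by (auto simp: row_def)
  ultimately have "b = b'"
    using inj_onD[OF bij_betw_imp_inj_on[OF numbering_bij[OF assms(1)]]] by blast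
  with \<open>b \<in> row n \<mu> h i\<close> \<open>b' \<in> row n \<mu> h' i'\<close> show ?thesis by (auto simp: row_def)
qed

lemma numbering_card_row:
  assumes "T \<in> numberings n m \<mu>" "h \<in> {1..n}" "i > 0"
  shows "finite (T ` row n \<mu> h i) \<and> card (T ` row n \<mu> h i) = \<mu> h i"
proof -
  have "inj_on T (row n \<mu> h i)"
    by (rule inj_on_subset[OF bij_betw_imp_inj_on[OF numbering_bij[OF assms(1)]]]) (auto simp: row_def)
  then show ?thesis using assms by (simp add: card_image card_row) (simp add: row_eq)
qed

lemma increasing_representative:
  assumes "T \<in> numberings n m \<mu>"
  shows "\<exists>T'. increasing_with_rows (\<lambda>h i. T ` row n \<mu> h i) T'"
proof (rule increasing_with_rows_exists)
  show "h = h' \<and> i = i'" if "N \<in> T ` row n \<mu> h i" "N \<in> T ` row n \<mu> h' i'" for N h i h' i'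
    using numbering_row_disjoint[OF assms that] .
  show "finite (T ` row n \<mu> h i) \<and> card (T ` row n \<mu> h i) = \<mu> h i" if "h \<in> {1..n}" "i > 0" for h i
    using numbering_card_row[OF assms that] .
qed (rule numbering_row_cover[OF assms])

end

section \<open>Orbits of the row shift and cycles of the standard permutation\<close>

text \<open>The places with value below \<open>k\<close> and those with value at most
  \<open>k\<close> are both initial segments; the level set is their difference.\<close>

lemma mono_level_set:
  fixes f :: "nat \<Rightarrow> nat"
  assumes "\<And>x y. 1 \<le> x \<Longrightarrow> x \<le> y \<Longrightarrow> y \<le> L \<Longrightarrow> f x \<le> f y"
  shows "{x \<in> {1..L}. f x = k} =
    {card {x \<in> {1..L}. f x < k} + 1..card {x \<in> {1..L}. f x < k} + card {x \<in> {1..L}. f x = k}}"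
proof -
  let ?A = "{x \<in> {1..L}. f x < k}" and ?B = "{x \<in> {1..L}. f x = k}"
  have A: "?A = {1..card ?A}"
    by (rule down_closed_eq) (use assms in \<open>auto intro: le_less_trans\<close>)
  have AB: "?A \<union> ?B = {1..card (?A \<union> ?B)}"
  proof (rule down_closed_eq)
    fix a b assume "b \<in> ?A \<union> ?B" "1 \<le> a" "a \<le> b"
    then show "a \<in> ?A \<union> ?B" using assms[of a b] by auto
  qed auto
  have "card (?A \<union> ?B) = card ?A + card ?B" by (rule card_Un_disjoint) auto
  then have "?A \<union> ?B = {1..card ?A + card ?B}" using AB by metis
  moreover have "?B = (?A \<union> ?B) - ?A" by auto
  ultimately have "?B = {1..card ?A + card ?B} - {1..card ?A}" using A by metis
  also have "\<dots> = {card ?A + 1..card ?A + card ?B}" by auto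
  finally show ?thesis .
qed

text \<open>The topmost row of the class of \<open>i\<close> when \<open>g\<close> divides
  \<open>l\<close>: same block, least position with the given residue.\<close>

definition row_base :: "nat \<Rightarrow> nat \<Rightarrow> nat \<Rightarrow> nat" where
  "row_base l g i = (i - Suc 0) div l * l + (i - Suc 0) mod g + 1"

text \<open>For \<open>g\<close> the gcd of \<open>l\<close> and \<open>j\<close> this is the orbit
  of row \<open>i\<close> under repeated shifts by \<open>j\<close>, and its rows are those of one
  tile.\<close>

definition row_class :: "nat \<Rightarrow> nat \<Rightarrow> nat \<Rightarrow> nat set" where
  "row_class l g i =
    {i'. i' > 0 \<and> (i' - Suc 0) div l = (i - Suc 0) div l \<and> (i' - Suc 0) mod g = (i - Suc 0) mod g}"

lemma row_class_self: "i > 0 \<Longrightarrow> i \<in> row_class l g i"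
  by (simp add: row_class_def)

lemma row_base_cong: "i' \<in> row_class l g i \<Longrightarrow> row_base l g i' = row_base l g i"
  by (simp add: row_class_def row_base_def)

lemma row_class_cong: "i' \<in> row_class l g i \<Longrightarrow> row_class l g i' = row_class l g i"
  by (simp add: row_class_def)

section \<open>Residue classes of rows as orbits of the shift\<close>

context
  fixes l g \<gamma> :: nat
  assumes l: "l = g * \<gamma>" "l > 0"
begin

text \<open>The position in the block is \<open>s * g + c\<close> with \<open>s < \<gamma>\<close>,
  so the class consists of equally spaced rows, the shape that the tile condition
  prescribes.\<close>

lemma row_class_eq_image: "row_class l g i = (\<lambda>s. row_base l g i + s * g) ` {..<\<gamma>}"
proof (intro equalityI subsetI)
  fix i' assume i': "i' \<in> row_class l g i"
  let ?r = "i' - Suc 0"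
  let ?s = "(?r mod l) div g"
  have "?r mod l < \<gamma> * g" using l by (simp add: mult.commute)
  then have s: "?s < \<gamma>" by (rule less_mult_imp_div_less)
  have "?r = ?r div l * l + (?s * g + (?r mod l) mod g)" by simp
  also have "(?r mod l) mod g = ?r mod g" using l by (simp add: mod_mod_cancel)
  finally have "i' = row_base l g i + ?s * g"
    using i' unfolding row_class_def row_base_def by (simp add: ac_simps)
  then show "i' \<in> (\<lambda>s. row_base l g i + s * g) ` {..<\<gamma>}" using s by blast
next
  fix i' assume "i' \<in> (\<lambda>s. row_base l g i + s * g) ` {..<\<gamma>}"
  then obtain s where s: "s < \<gamma>" "i' = row_base l g i + s * g" by auto
  let ?q = "(i - Suc 0) div l" and ?c = "(i - Suc 0) mod g"
  have g: "g > 0" using l by (auto intro: gr0I)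
  \<comment> \<open>The offset is bounded by \<open>l\<close>, so the row does not leave its
    block.\<close>
  have "?c + s * g < g + s * g" using g by simp
  also have "\<dots> = Suc s * g" by simp
  also have "\<dots> \<le> \<gamma> * g" using s(1) by (intro mult_le_mono1) simp
  finally have lt: "?c + s * g < l" using l by (simp add: mult.commute)
  have e: "i' - Suc 0 = ?q * l + (?c + s * g)" using s(2) by (simp add: row_base_def)
  have "(i' - Suc 0) div l = ?q" unfolding e using lt by simp
  moreover have "(i' - Suc 0) mod g = ?c" unfolding e l(1)
    by (metis mod_add_left_eq mod_mod_trivial mod_mult_self1 mod_mult_self3 mult.assoc mult.commute)
  ultimately show "i' \<in> row_class l g i" using s(2) by (simp add: row_class_def row_base_def)
qed

lemma card_row_class: "card (row_class l g i) = \<gamma>"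
proof -
  have "g > 0" using l by (auto intro: gr0I)
  then show ?thesis unfolding row_class_eq_image by (subst card_image) (auto simp: inj_on_def)
qed

lemma row_base_in_class: "row_base l g i \<in> row_class l g i"
proof -
  have "\<gamma> > 0" using l by (auto intro: gr0I)
  then show ?thesis unfolding row_class_eq_image by (auto intro: image_eqI[of _ _ 0])
qed

lemma row_base_le:
  assumes "i > 0" shows "row_base l g i \<le> i"
  using row_class_self[OF assms, of l g] unfolding row_class_eq_image by auto

context
  fixes j :: int
  assumes \<gamma>: "\<And>d. \<gamma> dvd d \<longleftrightarrow> int l dvd j * int d"
begin

text \<open>The instance \<open>d = \<gamma>\<close> says that \<open>g * \<gamma>\<close> divides
  \<open>j * \<gamma>\<close>. Hence shifts by multiples of \<open>j\<close> keep the residue modulo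
  \<open>g\<close>.\<close>

lemma gap_dvd: "int g dvd j"
proof -
  have "int l dvd j * int \<gamma>" using \<gamma>[of \<gamma>] by simp
  then show ?thesis using l by simp
qed

lemma shift_row_in_class: "shift_row l (j * int e) i \<in> row_class l g i"
proof -
  let ?r = "shift_row l (j * int e) i - Suc 0"
  have "int (?r mod g) = int (?r mod l) mod int g" using l by (simp add: mod_mod_cancel zmod_int)
  also have "\<dots> = (int (i - Suc 0) - j * int e) mod int g"
    unfolding shift_row_mod[OF l(2)] using l by (simp add: mod_mod_cancel)
  also have "\<dots> = int (i - Suc 0) mod int g"
    using gap_dvd by (simp add: mod_eq_dvd_iff)
  also have "\<dots> = int ((i - Suc 0) mod g)" by (simp add: zmod_int)
  finally have "?r mod g = (i - Suc 0) mod g" by linarith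
  then show ?thesis by (simp add: row_class_def shift_row_pos shift_row_div l(2))
qed

text \<open>The rows agree iff \<open>l\<close> divides \<open>j\<close> times the difference of the
  exponents, and that is the criterion for \<open>\<gamma>\<close>. It speaks of natural numbers, so
  the exponents are first put in order.\<close>

lemma shift_row_eq_iff_mod:
  "shift_row l (j * int e) i = shift_row l (j * int e') i \<longleftrightarrow> e mod \<gamma> = e' mod \<gamma>"
proof -
  have *: "shift_row l (j * int e) i = shift_row l (j * int e') i \<longleftrightarrow> e mod \<gamma> = e' mod \<gamma>"
    if "e' \<le> e" for e e'
  proof -
    have "shift_row l (j * int e) i = shift_row l (j * int e') i \<longleftrightarrow> int l dvd j * int (e - e')"
      unfolding shift_row_eq_iff[OF l(2)] using that by (simp add: algebra_simps of_nat_diff)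
    also have "\<dots> \<longleftrightarrow> e mod \<gamma> = e' mod \<gamma>"
      unfolding \<gamma>[symmetric] using that mod_eq_dvd_iff_nat by metis
    finally show ?thesis .
  qed
  show ?thesis using *[of e' e] *[of e e'] by (metis linear)
qed

text \<open>The first \<open>\<gamma>\<close> shifts are distinct and stay within a class of
  \<open>\<gamma>\<close> rows.\<close>

lemma shift_row_bij_class: "bij_betw (\<lambda>e. shift_row l (j * int e) i) {..<\<gamma>} (row_class l g i)"
proof -
  have inj: "inj_on (\<lambda>e. shift_row l (j * int e) i) {..<\<gamma>}"
    by (auto simp: inj_on_def shift_row_eq_iff_mod)
  moreover have "(\<lambda>e. shift_row l (j * int e) i) ` {..<\<gamma>} = row_class l g i"
  proof (rule card_subset_eq)
    show "finite (row_class l g i)" by (simp add: row_class_eq_image)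
    show "card ((\<lambda>e. shift_row l (j * int e) i) ` {..<\<gamma>}) = card (row_class l g i)"
      using card_image[OF inj] card_row_class by simp
  qed (use shift_row_in_class in auto)
  ultimately show ?thesis by (simp add: bij_betw_def)
qed

text \<open>The even spreading of a cycle: a row of the class is visited by one residue class of
  exponents modulo \<open>\<gamma>\<close>, which has \<open>p div \<gamma>\<close> members below
  \<open>p\<close>.\<close>

lemma card_shift_row_eq:
  assumes "\<gamma> dvd p"
  shows "card {e. e < p \<and> i' = shift_row l (j * int e) i} = (if i' \<in> row_class l g i then p div \<gamma> else 0)"
proof (cases "i' \<in> row_class l g i")
  case True
  have pos: "\<gamma> > 0" using l by (auto intro: gr0I)
  obtain e0 where e0: "e0 < \<gamma>" "i' = shift_row l (j * int e0) i"
    using True unfolding bij_betw_imp_surj_on[OF shift_row_bij_class, of i, symmetric] by auto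
  obtain w where w: "p = \<gamma> * w" using assms by auto
  have "{e. e < p \<and> i' = shift_row l (j * int e) i} = (\<lambda>v. e0 + \<gamma> * v) ` {..<w}"
  proof (intro equalityI subsetI)
    fix e assume "e \<in> {e. e < p \<and> i' = shift_row l (j * int e) i}"
    then have e: "e < \<gamma> * w" "e mod \<gamma> = e0"
      using e0 w shift_row_eq_iff_mod by auto
    then have "e div \<gamma> < w" by (simp add: less_mult_imp_div_less mult.commute)
    moreover have "e = e0 + \<gamma> * (e div \<gamma>)" using e(2) by (metis mod_mult_div_eq)
    ultimately show "e \<in> (\<lambda>v. e0 + \<gamma> * v) ` {..<w}" by blast
  next
    fix e assume "e \<in> (\<lambda>v. e0 + \<gamma> * v) ` {..<w}"
    then obtain v where v: "v < w" "e = e0 + \<gamma> * v" by auto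
    have "e < \<gamma> * Suc v" using v e0 by simp
    also have "\<dots> \<le> p" unfolding w using v(1) by (intro mult_le_mono2) simp
    finally have "e < p" .
    moreover have "e mod \<gamma> = e0 mod \<gamma>" using v by simp
    ultimately show "e \<in> {e. e < p \<and> i' = shift_row l (j * int e) i}"
      using e0(2) shift_row_eq_iff_mod by auto
  qed
  moreover have "inj_on (\<lambda>v. e0 + \<gamma> * v) {..<w}" using pos by (auto simp: inj_on_def)
  ultimately show ?thesis using True w pos by (simp add: card_image)
next
  case False
  then have "{e. e < p \<and> i' = shift_row l (j * int e) i} = {}" using shift_row_in_class by auto
  then show ?thesis using False by simp
qed

end

end

section \<open>Intervals of numbers as cycles of the standard permutation\<close>

context
  fixes \<rho> :: "nat \<Rightarrow> nat" and M :: nat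
  assumes \<rho>: "partition_of \<rho> M"
begin

text \<open>Index 0 carries the dummy part 0, so it has no cycle.\<close>

lemma interval_ne0: "e < \<rho> k \<Longrightarrow> k > 0"
  using \<rho> by (auto simp: partition_of_def intro: gr0I)

lemma n_start_add_le:
  assumes "0 < k" "k < k'" shows "n_start \<rho> k + \<rho> k \<le> n_start \<rho> k'"
proof -
  have "sum \<rho> {1..<k} + \<rho> k = sum \<rho> {1..<Suc k}" using assms by (simp add: sum.atLeastLessThan_Suc)
  also have "\<dots> \<le> sum \<rho> {1..<k'}" using assms by (intro sum_mono2) auto
  finally show ?thesis by (simp add: n_start_def)
qed

lemma interval_less:
  assumes "e < \<rho> k" "e' < \<rho> k'" "k < k'"
  shows "n_start \<rho> k + e < n_start \<rho> k' + e'"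
  using n_start_add_le[OF interval_ne0[OF assms(1)] assms(3)] assms(1) by linarith

lemma interval_unique:
  assumes "e < \<rho> k" "e' < \<rho> k'" "n_start \<rho> k + e = n_start \<rho> k' + e'"
  shows "k = k' \<and> e = e'"
proof -
  have "k = k'" using interval_less[OF assms(1,2)] interval_less[OF assms(2,1)] assms(3)
    by (metis less_irrefl linorder_neqE_nat)
  then show ?thesis using assms(3) by simp
qed

lemma interval_cover: "N \<in> {1..M} \<longleftrightarrow> (\<exists>k e. e < \<rho> k \<and> N = n_start \<rho> k + e)"
proof -
  obtain K where K: "\<And>i. i > K \<Longrightarrow> \<rho> i = 0" "sum \<rho> {1..K} = M"
    using partition_bound[OF \<rho>] by metis
  have "{1..M} = (\<lambda>(i, j). sum \<rho> {1..<i} + j) ` {(i, j). i \<in> {1..K} \<and> j \<in> {1..\<rho> i}}"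
    using bij_betw_imp_surj_on[OF stack_bij[of \<rho> K]] K(2) by simp
  then have "N \<in> {1..M} \<longleftrightarrow> (\<exists>k y. k \<in> {1..K} \<and> y \<in> {1..\<rho> k} \<and> N = sum \<rho> {1..<k} + y)"
    by (auto simp: image_iff)
  also have "\<dots> \<longleftrightarrow> (\<exists>k e. e < \<rho> k \<and> N = n_start \<rho> k + e)"
  proof
    assume "\<exists>k y. k \<in> {1..K} \<and> y \<in> {1..\<rho> k} \<and> N = sum \<rho> {1..<k} + y"
    then obtain k y where "y \<in> {1..\<rho> k}" "N = sum \<rho> {1..<k} + y" by auto
    then show "\<exists>k e. e < \<rho> k \<and> N = n_start \<rho> k + e"
      by (intro exI[of _ k] exI[of _ "y - 1"]) (auto simp: n_start_def)
  next
    assume "\<exists>k e. e < \<rho> k \<and> N = n_start \<rho> k + e"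
    then obtain k e where ke: "e < \<rho> k" "N = n_start \<rho> k + e" by auto
    then have "k \<in> {1..K}" using interval_ne0[OF ke(1)] K(1)[of k] by (force simp: not_less[symmetric])
    then show "\<exists>k y. k \<in> {1..K} \<and> y \<in> {1..\<rho> k} \<and> N = sum \<rho> {1..<k} + y"
      using ke by (intro exI[of _ k] exI[of _ "Suc e"]) (auto simp: n_start_def)
  qed
  finally show ?thesis .
qed

lemma sigma_perm_interval:
  assumes "e < \<rho> k" shows "sigma_perm \<rho> (n_start \<rho> k + e) = n_start \<rho> k + Suc e mod \<rho> k"
proof -
  let ?f = "\<lambda>k. [n_start \<rho> k..<n_start \<rho> k + \<rho> k]"
  have fin: "finite {i. \<rho> i \<noteq> 0}" using \<rho> by (simp add: partition_of_def)
  have "sigma_perm \<rho> = perm_prod (map (\<lambda>k. cycle_of_list (?f k)) (sorted_list_of_set {i. \<rho> i \<noteq> 0}))"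
    by (simp add: sigma_perm_def sigma_cycle_def[abs_def])
  moreover have "perm_prod (map (\<lambda>k. cycle_of_list (?f k)) (sorted_list_of_set {i. \<rho> i \<noteq> 0})) (?f k ! e) =
      ?f k ! (Suc e mod length (?f k))"
  proof (rule perm_prod_cycles_nth)
    fix a b :: nat assume "a \<noteq> b"
    show "set (?f a) \<inter> set (?f b) = {}"
    proof (rule ccontr)
      assume "set (?f a) \<inter> set (?f b) \<noteq> {}"
      then obtain N where "N \<in> {n_start \<rho> a..<n_start \<rho> a + \<rho> a}" "N \<in> {n_start \<rho> b..<n_start \<rho> b + \<rho> b}"
        unfolding set_upt by blast
      then show False
        using interval_unique[of "N - n_start \<rho> a" a "N - n_start \<rho> b" b] \<open>a \<noteq> b\<close>
        by (simp add: less_diff_conv2 add.commute)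
    qed
  qed (use assms fin in auto)
  moreover have "Suc e mod \<rho> k < \<rho> k" using assms by simp
  ultimately show ?thesis using assms by simp
qed

lemma sigma_perm_permutes: "sigma_perm \<rho> permutes {1..M}"
proof -
  have "n_start \<rho> k \<le> N \<Longrightarrow> N < n_start \<rho> k + \<rho> k \<Longrightarrow> N \<in> {1..M}" for k N
    unfolding interval_cover by (intro exI[of _ k] exI[of _ "N - n_start \<rho> k"]) linarith
  then have "perm_prod (map (\<lambda>k. cycle_of_list [n_start \<rho> k..<n_start \<rho> k + \<rho> k])
      (sorted_list_of_set {i. \<rho> i \<noteq> 0})) permutes {1..M}"
    by (intro perm_prod_cycles_permutes) auto
  then show ?thesis by (simp add: sigma_perm_def sigma_cycle_def[abs_def])
qed

end

section \<open>Numberings determined by the first elements of the cycles\<close>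

text \<open>The orders enter only through the divisibility criterion, which forces
  \<open>\<gamma> h\<close> to be the quotient of \<open>l h\<close> by the gcd of
  \<open>l h\<close> and \<open>j\<close>.\<close>

locale cycle_tiling = multi_shape +
  fixes \<rho> \<gamma> :: "nat \<Rightarrow> nat" and j :: int
  assumes \<rho>: "partition_of \<rho> box_count"
    and \<gamma>: "\<And>h d. h \<in> {1..n} \<Longrightarrow> \<gamma> h dvd d \<longleftrightarrow> int (l h) dvd j * int d"
begin

abbreviation "gap h \<equiv> l h div \<gamma> h"

lemma gap:
  assumes "h \<in> {1..n}"
  shows "l h = gap h * \<gamma> h" and "gap h > 0" and "\<gamma> h > 0"
proof -
  have "\<gamma> h dvd l h" using \<gamma>[OF assms, of "l h"] by simp
  then show e: "l h = gap h * \<gamma> h" by simp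
  show "gap h > 0" using e l_pos[OF assms] by (cases "gap h") auto
  show "\<gamma> h > 0" using e l_pos[OF assms] by (cases "\<gamma> h") auto
qed

text \<open>The reduced description of an invariant numbering: component \<open>H k\<close> and row
  \<open>I k\<close> of the first element of cycle \<open>k\<close>. The divisibility says that the
  placement closes up after \<open>\<rho> k\<close> steps.\<close>

definition cycle_data :: "(nat \<Rightarrow> nat) \<Rightarrow> (nat \<Rightarrow> nat) \<Rightarrow> bool" where
  "cycle_data H I \<longleftrightarrow> (\<forall>k. \<rho> k \<noteq> 0 \<longrightarrow> H k \<in> {1..n} \<and> I k > 0 \<and> \<gamma> (H k) dvd \<rho> k)"

text \<open>The row contents forced by the step rule: going \<open>e\<close> steps along a cycle
  costs \<open>e\<close> shifts by \<open>j\<close>.\<close>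

definition cycle_rows :: "(nat \<Rightarrow> nat) \<Rightarrow> (nat \<Rightarrow> nat) \<Rightarrow> nat \<Rightarrow> nat \<Rightarrow> nat set" where
  "cycle_rows H I h i = {N. \<exists>k e. e < \<rho> k \<and> N = n_start \<rho> k + e \<and> h = H k \<and>
     i = shift_row (l h) (j * int e) (I k)}"

lemma cycle_rowsI:
  "e < \<rho> k \<Longrightarrow> n_start \<rho> k + e \<in> cycle_rows H I (H k) (shift_row (l (H k)) (j * int e) (I k))"
  unfolding cycle_rows_def by blast

text \<open>The number of elements of cycle \<open>k\<close> in row \<open>i\<close> of component
  \<open>h\<close>, which is also the width of tile \<open>k\<close> in that row.\<close>

definition row_share :: "(nat \<Rightarrow> nat) \<Rightarrow> (nat \<Rightarrow> nat) \<Rightarrow> nat \<Rightarrow> nat \<Rightarrow> nat \<Rightarrow> nat" where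
  "row_share H I k h i = (if h = H k \<and> i \<in> row_class (l h) (gap h) (I k) then \<rho> k div \<gamma> h else 0)"

lemma finite_support: "finite {k. \<rho> k \<noteq> 0}"
  using \<rho> by (simp add: partition_of_def)

lemma cycle_rows_step:
  assumes "cycle_data H I" "N \<in> cycle_rows H I h i"
  shows "sigma_perm \<rho> N \<in> cycle_rows H I h (shift_row (l h) j i)"
proof -
  obtain k e where e: "e < \<rho> k" "N = n_start \<rho> k + e" and h: "h = H k"
    and i: "i = shift_row (l h) (j * int e) (I k)"
    using assms(2) by (auto simp: cycle_rows_def)
  have hn: "h \<in> {1..n}" and dv: "\<gamma> h dvd \<rho> k" using assms(1) e h by (auto simp: cycle_data_def)
  have "shift_row (l h) j i = shift_row (l h) (j * int (Suc e)) (I k)"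
    by (simp add: i shift_row_shift_row[OF l_pos[OF hn]] algebra_simps)
  \<comment> \<open>Only the return from the last element of the cycle to the first needs an
    argument: \<open>\<rho> k\<close> shifts by \<open>j\<close> act trivially because
    \<open>\<gamma> h\<close> divides \<open>\<rho> k\<close>.\<close>
  also have "\<dots> = shift_row (l h) (j * int (Suc e mod \<rho> k)) (I k)"
    unfolding shift_row_eq_iff_mod[OF gap(1)[OF hn] l_pos[OF hn] \<gamma>[OF hn]] using dv
    by (simp add: mod_mod_cancel)
  finally show ?thesis
    using sigma_perm_interval[OF \<rho> e(1)] e h cycle_rowsI[of "Suc e mod \<rho> k" k H I] by simp
qed

lemma cycle_rows_disjoint:
  assumes "N \<in> cycle_rows H I h i" "N \<in> cycle_rows H I h' i'"
  shows "h = h' \<and> i = i'"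
  using assms interval_unique[OF \<rho>] unfolding cycle_rows_def by blast

lemma cycle_rows_cover:
  assumes "cycle_data H I"
  shows "(\<Union>h\<in>{1..n}. \<Union>i\<in>{0<..}. cycle_rows H I h i) = {1..box_count}"
proof (intro equalityI subsetI)
  fix N assume "N \<in> (\<Union>h\<in>{1..n}. \<Union>i\<in>{0<..}. cycle_rows H I h i)"
  then show "N \<in> {1..box_count}" unfolding interval_cover[OF \<rho>] cycle_rows_def by blast
next
  fix N assume "N \<in> {1..box_count}"
  then obtain k e where e: "e < \<rho> k" "N = n_start \<rho> k + e" unfolding interval_cover[OF \<rho>] by blast
  then have "H k \<in> {1..n}" using assms by (auto simp: cycle_data_def)
  moreover have "N \<in> cycle_rows H I (H k) (shift_row (l (H k)) (j * int e) (I k))"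
    using e cycle_rowsI by simp
  ultimately show "N \<in> (\<Union>h\<in>{1..n}. \<Union>i\<in>{0<..}. cycle_rows H I h i)"
    using shift_row_pos by blast
qed

text \<open>The restriction to a set \<open>A\<close> of cycles allows counting the entries of the
  cycles before a given one, which yields the column offset of a tile.\<close>

lemma card_cycle_rows:
  assumes "cycle_data H I" "A \<subseteq> {k. \<rho> k \<noteq> 0}"
  shows "card {N \<in> cycle_rows H I h i. \<exists>k\<in>A. \<exists>e<\<rho> k. N = n_start \<rho> k + e} =
    (\<Sum>k\<in>A. row_share H I k h i)"
proof -
  define E where "E k = {e. e < \<rho> k \<and> h = H k \<and> i = shift_row (l h) (j * int e) (I k)}" for k
  have finE: "finite (E k)" for k by (rule finite_subset[of _ "{..<\<rho> k}"]) (auto simp: E_def)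
  have finA: "finite A" using assms(2) finite_support finite_subset by blast
  have "{N \<in> cycle_rows H I h i. \<exists>k\<in>A. \<exists>e<\<rho> k. N = n_start \<rho> k + e} =
      (\<Union>k\<in>A. (\<lambda>e. n_start \<rho> k + e) ` E k)"
  proof (intro equalityI subsetI)
    fix N assume "N \<in> {N \<in> cycle_rows H I h i. \<exists>k\<in>A. \<exists>e<\<rho> k. N = n_start \<rho> k + e}"
    then obtain k e k' e' where *: "e < \<rho> k" "N = n_start \<rho> k + e" "h = H k"
      "i = shift_row (l h) (j * int e) (I k)" "k' \<in> A" "e' < \<rho> k'" "N = n_start \<rho> k' + e'"
      unfolding cycle_rows_def by blast
    then have "k = k'" using interval_unique[OF \<rho> *(1,6)] by simp
    then show "N \<in> (\<Union>k\<in>A. (\<lambda>e. n_start \<rho> k + e) ` E k)" using * unfolding E_def by blast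
  qed (auto simp: E_def cycle_rows_def)
  moreover have "card (\<Union>k\<in>A. (\<lambda>e. n_start \<rho> k + e) ` E k) = (\<Sum>k\<in>A. card ((\<lambda>e. n_start \<rho> k + e) ` E k))"
  proof (rule card_UN_disjoint)
    show "\<forall>k\<in>A. \<forall>k'\<in>A. k \<noteq> k' \<longrightarrow> (\<lambda>e. n_start \<rho> k + e) ` E k \<inter> (\<lambda>e. n_start \<rho> k' + e) ` E k' = {}"
    proof (intro ballI impI)
      fix k k' :: nat assume "k \<noteq> k'"
      then show "(\<lambda>e. n_start \<rho> k + e) ` E k \<inter> (\<lambda>e. n_start \<rho> k' + e) ` E k' = {}"
        using interval_unique[OF \<rho>] unfolding E_def by blast
    qed
  qed (use finA finE in auto)
  moreover have "card ((\<lambda>e. n_start \<rho> k + e) ` E k) = row_share H I k h i" if "k \<in> A" for k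
  proof -
    have "card ((\<lambda>e. n_start \<rho> k + e) ` E k) = card (E k)" by (simp add: card_image)
    also have "\<dots> = row_share H I k h i"
    proof (cases "h = H k")
      case True
      have hn: "h \<in> {1..n}" and dv: "\<gamma> h dvd \<rho> k"
        using assms that True by (auto simp: cycle_data_def)
      show ?thesis
        using card_shift_row_eq[OF gap(1)[OF hn] l_pos[OF hn] \<gamma>[OF hn] dv, of i "I k"] True
        by (simp add: E_def row_share_def)
    qed (simp add: E_def row_share_def)
    finally show ?thesis .
  qed
  ultimately show ?thesis by simp
qed

lemma card_cycle_rows_all:
  assumes "cycle_data H I"
  shows "finite (cycle_rows H I h i)"
    and "card (cycle_rows H I h i) = (\<Sum>k | \<rho> k \<noteq> 0. row_share H I k h i)"
proof -
  have "cycle_rows H I h i \<subseteq> {1..box_count}"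
    unfolding cycle_rows_def subset_iff interval_cover[OF \<rho>] by blast
  then show "finite (cycle_rows H I h i)" using finite_subset by blast
  have "{N \<in> cycle_rows H I h i. \<exists>k\<in>{k. \<rho> k \<noteq> 0}. \<exists>e<\<rho> k. N = n_start \<rho> k + e} = cycle_rows H I h i"
    unfolding cycle_rows_def by force
  then show "card (cycle_rows H I h i) = (\<Sum>k | \<rho> k \<noteq> 0. row_share H I k h i)"
    using card_cycle_rows[OF assms subset_refl, of h i] by simp
qed

lemma increasing_with_cycle_rows:
  assumes "cycle_data H I"
    and "\<And>h i. h \<in> {1..n} \<Longrightarrow> i > 0 \<Longrightarrow> (\<Sum>k | \<rho> k \<noteq> 0. row_share H I k h i) = \<mu> h i"
  shows "\<exists>T. increasing_with_rows (cycle_rows H I) T"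
proof (rule increasing_with_rows_exists)
  show "finite (cycle_rows H I h i) \<and> card (cycle_rows H I h i) = \<mu> h i" if "h \<in> {1..n}" "i > 0" for h i
    using card_cycle_rows_all[OF assms(1)] assms(2)[OF that] by simp
  show "h = h' \<and> i = i'" if "N \<in> cycle_rows H I h i" "N \<in> cycle_rows H I h' i'" for N h i h' i'
    using cycle_rows_disjoint[OF that] .
qed (rule cycle_rows_cover[OF assms(1)])

text \<open>The step rule gives one inclusion. Equality follows by counting, as the permutation is
  injective and the two rows have the same length.\<close>

lemma sigma_cycle_rows:
  assumes d: "cycle_data H I" and T: "increasing_with_rows (cycle_rows H I) T"
    and hi: "h \<in> {1..n}" "i > 0"
  shows "sigma_perm \<rho> ` T ` row n \<mu> h i = T ` row n \<mu> h (shift_row (l h) j i)"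
proof (rule card_subset_eq)
  have Tn: "T \<in> numberings n m \<mu>" using T by (simp add: increasing_with_rows_def)
  have r: "T ` row n \<mu> h i = cycle_rows H I h i" if "i > 0" for i
    using T hi(1) that by (simp add: increasing_with_rows_def)
  show "finite (T ` row n \<mu> h (shift_row (l h) j i))"
    using numbering_card_row[OF Tn hi(1) shift_row_pos] by simp
  show "sigma_perm \<rho> ` T ` row n \<mu> h i \<subseteq> T ` row n \<mu> h (shift_row (l h) j i)"
    unfolding r[OF hi(2)] r[OF shift_row_pos] using cycle_rows_step[OF d] by blast
  have "card (sigma_perm \<rho> ` T ` row n \<mu> h i) = card (T ` row n \<mu> h i)"
    by (rule card_image) (rule inj_on_subset[OF permutes_inj[OF sigma_perm_permutes[OF \<rho>]]], simp)
  then show "card (sigma_perm \<rho> ` T ` row n \<mu> h i) = card (T ` row n \<mu> h (shift_row (l h) j i))"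
    using numbering_card_row[OF Tn hi(1) hi(2)] numbering_card_row[OF Tn hi(1) shift_row_pos]
      shape_shift_row[OF hi] by simp
qed

text \<open>The rules of \<open>placed\<close> can be run around a cycle any number of times, so
  their consistency is not built in; it comes from \<open>cycle_rows_step\<close>. Conversely,
  \<open>e\<close> steps from the first element reach the number at offset \<open>e\<close>.\<close>

lemma placed_eq_cycle_rows:
  assumes d: "cycle_data H I"
    and H: "\<And>k h. \<rho> k \<noteq> 0 \<Longrightarrow> fiber_in n \<mu> Y k h \<longleftrightarrow> h = H k"
    and I: "\<And>k. \<rho> k \<noteq> 0 \<Longrightarrow>
      sorted_list_of_set ((\<lambda>(i, j, h). i) ` fiber n \<mu> Y k) ! (snd (c k) - 1) = I k"
  shows "{N. placed n \<mu> \<rho> l j Y c N h i} = cycle_rows H I h i"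
proof (intro equalityI subsetI)
  fix N assume "N \<in> {N. placed n \<mu> \<rho> l j Y c N h i}"
  then have "placed n \<mu> \<rho> l j Y c N h i" by simp
  then show "N \<in> cycle_rows H I h i"
  proof (induction rule: placed.induct)
    case (start k h)
    have "I k > 0" using d start by (simp add: cycle_data_def)
    then show ?case
      unfolding I[OF start(1)] using start H cycle_rowsI[of 0 k H I] by (simp add: shift_row_0)
  next
    case (step N h i)
    then show ?case using cycle_rows_step[OF d] by blast
  qed
next
  fix N assume "N \<in> cycle_rows H I h i"
  then obtain k e where e: "e < \<rho> k" and N: "N = n_start \<rho> k + e" and h: "h = H k"
    and i: "i = shift_row (l h) (j * int e) (I k)"
    by (auto simp: cycle_rows_def)
  have hn: "h \<in> {1..n}" and I0: "I k > 0" using d e h by (auto simp: cycle_data_def)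
  from e have "placed n \<mu> \<rho> l j Y c (n_start \<rho> k + e) h (shift_row (l h) (j * int e) (I k))"
  proof (induction e)
    case 0
    then have "placed n \<mu> \<rho> l j Y c (n_start \<rho> k) h (I k)"
      using placed.start[where k = k and h = h and Y = Y and c = c and \<rho> = \<rho>] H I h by force
    then show ?case using I0 by (simp add: shift_row_0)
  next
    case (Suc e)
    then have "placed n \<mu> \<rho> l j Y c (sigma_perm \<rho> (n_start \<rho> k + e)) h
        (shift_row (l h) j (shift_row (l h) (j * int e) (I k)))"
      by (intro placed.step) simp
    then show ?case
      using Suc.prems sigma_perm_interval[OF \<rho>, of e k]
      by (simp add: shift_row_shift_row[OF l_pos[OF hn]] algebra_simps)
  qed
  then show "N \<in> {N. placed n \<mu> \<rho> l j Y c N h i}" using N i by simp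
qed

end

section \<open>Tilings give fixed tabloids\<close>

context cycle_tiling
begin

lemma finite_boxes: "finite (boxes n \<mu>)"
  using bij_betw_finite[OF numbering_bij[OF std_numbering_in]] by simp

lemma shape_row_class:
  assumes "h \<in> {1..n}" "i > 0" "i' \<in> row_class (l h) g i"
  shows "\<mu> h i' = \<mu> h i"
  using l_partition_block[OF l_part[OF assms(1)] l_pos[OF assms(1)], of i' i] assms(2,3)
  by (simp add: row_class_def Suc_le_eq)

text \<open>Replaces the integer offsets by natural coordinates: the top row \<open>i0\<close> of
  the tile and the last column \<open>x0\<close> before it.\<close>

lemma rgl_tile:
  assumes Y: "rgl_tabloid n \<mu> \<rho> \<gamma> l Y" and k: "\<rho> k \<noteq> 0"
  shows "\<exists>h i0 x0. h \<in> {1..n} \<and> \<gamma> h dvd \<rho> k \<and> i0 > 0 \<and>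
    (\<forall>i x h'. (i, x, h') \<in> fiber n \<mu> Y k \<longleftrightarrow>
       h' = h \<and> (\<exists>s<\<gamma> h. i = i0 + s * gap h) \<and> x \<in> {x0 + 1..x0 + \<rho> k div \<gamma> h})"
proof -
  let ?J = "\<lambda>(i, x, h). (int i, int x, h)" and ?F = "fiber n \<mu> Y k"
  have k1: "k \<ge> 1" using k \<rho> by (cases k) (auto simp: partition_of_def)
  obtain h i' j' where h: "h \<in> {1..n}" and dv: "\<gamma> h dvd \<rho> k" and
    F: "?J ` ?F = {(int s * int (gap h) + i', int t + j', h) | s t.
             1 \<le> s \<and> s \<le> \<gamma> h \<and> 1 \<le> t \<and> t \<le> \<rho> k div \<gamma> h}"
    using Y[unfolded rgl_tabloid_def, THEN conjunct2, THEN conjunct2, THEN conjunct1, rule_format, OF k1]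
    by (elim bexE exE conjE) (rule that)
  have w: "\<rho> k div \<gamma> h \<ge> 1" using dv k by (auto elim!: dvdE)
  have mem: "(i, x, h') \<in> ?F \<longleftrightarrow> h' = h \<and> (\<exists>s. 1 \<le> s \<and> s \<le> \<gamma> h \<and> int i = int s * int (gap h) + i') \<and>
      (\<exists>t. 1 \<le> t \<and> t \<le> \<rho> k div \<gamma> h \<and> int x = int t + j')" for i x h'
  proof -
    have "(i, x, h') \<in> ?F \<longleftrightarrow> (int i, int x, h') \<in> ?J ` ?F" by force
    then show ?thesis unfolding F by auto
  qed
  \<comment> \<open>The corner \<open>s = t = 1\<close> is a box of the fibre, so its coordinates
    are positive; they are \<open>i0\<close> and \<open>x0 + 1\<close>.\<close>
  have "(int 1 * int (gap h) + i', int 1 + j', h) \<in> ?J ` ?F"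
    unfolding F using gap(3)[OF h] w by fastforce
  then obtain i0 x1 where 1: "(i0, x1, h) \<in> ?F" "int i0 = int (gap h) + i'" "int x1 = 1 + j'"
    by (auto simp: image_iff)
  then have pos: "i0 > 0" "x1 \<ge> 1" by (auto simp: fiber_def mem_boxes)
  have row: "(\<exists>s. 1 \<le> s \<and> s \<le> \<gamma> h \<and> int i = int s * int (gap h) + i') \<longleftrightarrow>
      (\<exists>s<\<gamma> h. i = i0 + s * gap h)" for i
  proof
    assume "\<exists>s. 1 \<le> s \<and> s \<le> \<gamma> h \<and> int i = int s * int (gap h) + i'"
    then obtain s where s: "1 \<le> s" "s \<le> \<gamma> h" "int i = int s * int (gap h) + i'" by auto
    then obtain s' where s': "s = Suc s'" by (cases s) auto
    have "int i = int (i0 + s' * gap h)" using s(3) 1(2) s' by (simp add: algebra_simps)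
    then have "i = i0 + s' * gap h" by linarith
    then show "\<exists>s<\<gamma> h. i = i0 + s * gap h" using s(2) s' by (intro exI[of _ s']) simp
  next
    assume "\<exists>s<\<gamma> h. i = i0 + s * gap h"
    then obtain s where "s < \<gamma> h" "i = i0 + s * gap h" by auto
    then show "\<exists>s. 1 \<le> s \<and> s \<le> \<gamma> h \<and> int i = int s * int (gap h) + i'"
      using 1(2) by (intro exI[of _ "Suc s"]) (simp add: algebra_simps)
  qed
  have col: "(\<exists>t. 1 \<le> t \<and> t \<le> \<rho> k div \<gamma> h \<and> int x = int t + j') \<longleftrightarrow>
      x \<in> {(x1 - 1) + 1..(x1 - 1) + \<rho> k div \<gamma> h}" for x
  proof
    assume "x \<in> {(x1 - 1) + 1..(x1 - 1) + \<rho> k div \<gamma> h}"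
    then show "\<exists>t. 1 \<le> t \<and> t \<le> \<rho> k div \<gamma> h \<and> int x = int t + j'"
      using 1(3) pos(2) by (intro exI[of _ "x - (x1 - 1)"]) (auto simp: of_nat_diff)
  qed (use 1(3) pos(2) in auto)
  show ?thesis
    using h dv pos(1) mem row col by (intro exI[of _ h] exI[of _ i0] exI[of _ "x1 - 1"]) simp
qed

lemma rgl_support:
  assumes Y: "rgl_tabloid n \<mu> \<rho> \<gamma> l Y" and b: "b \<in> boxes n \<mu>"
  shows "\<rho> (Y b) \<noteq> 0" and "b \<in> fiber n \<mu> Y (Y b)"
proof -
  show bf: "b \<in> fiber n \<mu> Y (Y b)" using b by (simp add: fiber_def)
  have "finite (fiber n \<mu> Y (Y b))" using finite_boxes by (simp add: fiber_def)
  then have "card (fiber n \<mu> Y (Y b)) \<noteq> 0" using bf by auto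
  moreover have "Y b \<ge> 1" using Y b unfolding rgl_tabloid_def by (auto simp: PiE_iff)
  ultimately show "\<rho> (Y b) \<noteq> 0" using Y unfolding rgl_tabloid_def by metis
qed

text \<open>The tile condition alone allows a tile to run across two blocks of \<open>l h\<close> rows. It cannot
  happen: the topmost rows of the diagram are covered by tiles starting in the first block, these
  use up that block, and so on downwards.\<close>

lemma rgl_tile_class:
  assumes Y: "rgl_tabloid n \<mu> \<rho> \<gamma> l Y"
  shows "\<exists>H I X. \<forall>k. \<rho> k \<noteq> 0 \<longrightarrow> H k \<in> {1..n} \<and> \<gamma> (H k) dvd \<rho> k \<and> I k > 0 \<and>
    (\<forall>i x h. (i, x, h) \<in> fiber n \<mu> Y k \<longleftrightarrow> h = H k \<and>
       i \<in> row_class (l (H k)) (gap (H k)) (I k) \<and> x \<in> {X k + 1..X k + \<rho> k div \<gamma> (H k)})"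
proof -
  have "\<forall>k. \<exists>h i0 x0. \<rho> k \<noteq> 0 \<longrightarrow> h \<in> {1..n} \<and> \<gamma> h dvd \<rho> k \<and> i0 > 0 \<and>
    (\<forall>i x h'. (i, x, h') \<in> fiber n \<mu> Y k \<longleftrightarrow>
       h' = h \<and> (\<exists>s<\<gamma> h. i = i0 + s * gap h) \<and> x \<in> {x0 + 1..x0 + \<rho> k div \<gamma> h})"
    using rgl_tile[OF Y] by blast
  then obtain H I X where t: "\<forall>k. \<rho> k \<noteq> 0 \<longrightarrow> H k \<in> {1..n} \<and> \<gamma> (H k) dvd \<rho> k \<and> I k > 0 \<and>
    (\<forall>i x h'. (i, x, h') \<in> fiber n \<mu> Y k \<longleftrightarrow> h' = H k \<and>
       (\<exists>s<\<gamma> (H k). i = I k + s * gap (H k)) \<and> x \<in> {X k + 1..X k + \<rho> k div \<gamma> (H k)})"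
    unfolding choice_iff by blast
  then have H: "\<And>k. \<rho> k \<noteq> 0 \<Longrightarrow> H k \<in> {1..n}" and dv: "\<And>k. \<rho> k \<noteq> 0 \<Longrightarrow> \<gamma> (H k) dvd \<rho> k"
    and I: "\<And>k. \<rho> k \<noteq> 0 \<Longrightarrow> I k > 0" and
    mem: "\<And>k i x h. \<rho> k \<noteq> 0 \<Longrightarrow> (i, x, h) \<in> fiber n \<mu> Y k \<longleftrightarrow> h = H k \<and>
       (\<exists>s<\<gamma> (H k). i = I k + s * gap (H k)) \<and> x \<in> {X k + 1..X k + \<rho> k div \<gamma> (H k)}"
    by blast+
  have cls: "row_class (l h) (gap h) i = (\<lambda>s. row_base (l h) (gap h) i + s * gap h) ` {..<\<gamma> h}"
    if "h \<in> {1..n}" for h i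
    using row_class_eq_image[OF gap(1)[OF that] l_pos[OF that]] .
  note Yne = rgl_support[OF Y]
  \<comment> \<open>Strong induction on the row makes the descent through the blocks precise; the
    column stays fixed.\<close>
  have top: "I (Y (i, x, h)) = row_base (l h) (gap h) i" if "(i, x, h) \<in> boxes n \<mu>" for i x h
    using that
  proof (induction i rule: less_induct)
    case (less i)
    have hn: "h \<in> {1..n}" and i0: "i > 0" using less.prems by (auto simp: mem_boxes)
    define k where "k = Y (i, x, h)"
    have k: "\<rho> k \<noteq> 0" and fk: "(i, x, h) \<in> fiber n \<mu> Y k" using Yne[OF less.prems] by (auto simp: k_def)
    then have hk: "h = H k" unfolding mem[OF k] by blast
    have "\<exists>s<\<gamma> h. i = I k + s * gap h" and x: "x \<in> {X k + 1..X k + \<rho> k div \<gamma> h}"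
      using fk unfolding mem[OF k] hk by blast+
    then obtain s where s: "s < \<gamma> h" "i = I k + s * gap h" by blast
    show ?case
    proof (cases "I k < i")
      case True
      \<comment> \<open>Below the top row of its tile: induction applies to the top box in the same
        column, and the spacing keeps \<open>i\<close> in the class of that box.\<close>
      have "(I k, x, h) \<in> fiber n \<mu> Y k"
        unfolding mem[OF k] using hk x gap(3)[OF hn] by (auto intro: exI[of _ 0])
      then have b: "(I k, x, h) \<in> boxes n \<mu>" "Y (I k, x, h) = k" by (auto simp: fiber_def)
      then have e: "I k = row_base (l h) (gap h) (I k)" using less.IH[OF True b(1)] by simp
      have "i \<in> row_class (l h) (gap h) (I k)"
        unfolding cls[OF hn] using s e by (intro image_eqI[of _ _ s]) auto
      then have "row_base (l h) (gap h) i = row_base (l h) (gap h) (I k)" by (rule row_base_cong)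
      then show ?thesis using e by (simp add: k_def)
    next
      case False
      then have iI: "I k = i" using s by simp
      let ?b = "row_base (l h) (gap h) i"
      show ?thesis
      proof (cases "?b = i")
        case True
        then show ?thesis using iI by (simp add: k_def)
      next
        case False
        \<comment> \<open>If a tile started below the top row of the class, the tile at that top row
          in the same column would also run through row \<open>i\<close>, hence be the same
          tile.\<close>
        then have lt: "?b < i"
          using row_base_le[OF gap(1)[OF hn] l_pos[OF hn] i0] by simp
        have bc: "?b \<in> row_class (l h) (gap h) i"
          using row_base_in_class[OF gap(1)[OF hn] l_pos[OF hn]] .
        then have "?b > 0" by (simp add: row_class_def)
        then have b: "(?b, x, h) \<in> boxes n \<mu>"
          using less.prems shape_row_class[OF hn i0 bc] by (simp add: mem_boxes)
        define k' where "k' = Y (?b, x, h)"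
        have k': "\<rho> k' \<noteq> 0" and fk': "(?b, x, h) \<in> fiber n \<mu> Y k'" using Yne[OF b] by (auto simp: k'_def)
        have "I k' = row_base (l h) (gap h) ?b" using less.IH[OF lt b] by (simp add: k'_def)
        then have Ik': "I k' = ?b" using row_base_cong[OF bc] by simp
        have hk': "h = H k'" using fk' unfolding mem[OF k'] by blast
        have x': "x \<in> {X k' + 1..X k' + \<rho> k' div \<gamma> h}" using fk' unfolding mem[OF k'] hk' by blast
        have "\<exists>s<\<gamma> h. i = I k' + s * gap h"
          using row_class_self[OF i0, of "l h" "gap h"] unfolding cls[OF hn] Ik' by auto
        then have "(i, x, h) \<in> fiber n \<mu> Y k'" unfolding mem[OF k'] using hk' x' by simp
        then have "k' = k" by (simp add: fiber_def k_def)
        then show ?thesis using Ik' by (simp add: k_def)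
      qed
    qed
  qed
  have "(\<exists>s<\<gamma> (H k). i = I k + s * gap (H k)) \<longleftrightarrow> i \<in> row_class (l (H k)) (gap (H k)) (I k)"
    if k: "\<rho> k \<noteq> 0" for k i
  proof -
    \<comment> \<open>A tile of positive width has a box in its first row, where \<open>top\<close>
      shows that this row heads its class.\<close>
    have "\<rho> k div \<gamma> (H k) \<ge> 1" using dv[OF k] k by (auto elim!: dvdE)
    then have "(I k, X k + 1, H k) \<in> fiber n \<mu> Y k"
      unfolding mem[OF k] using gap(3)[OF H[OF k]] by (auto intro: exI[of _ 0])
    then have "(I k, X k + 1, H k) \<in> boxes n \<mu>" "Y (I k, X k + 1, H k) = k" by (auto simp: fiber_def)
    then have "I k = row_base (l (H k)) (gap (H k)) (I k)" using top by metis
    then show ?thesis unfolding cls[OF H[OF k]] by (metis (no_types, lifting) image_iff lessThan_iff)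
  qed
  then show ?thesis using H dv I mem by (intro exI[of _ H] exI[of _ I] exI[of _ X]) simp
qed

text \<open>A nonempty fibre is needed for \<open>fiber_in\<close> to single out a component: for an
  empty one it holds for every component.\<close>

lemma fiber_tile:
  assumes mem: "\<And>i x h'. (i, x, h') \<in> fiber n \<mu> Y k \<longleftrightarrow> h' = h \<and> i \<in> R \<and> x \<in> {x0 + 1..x0 + w}"
    and w: "w \<ge> 1" and h: "h \<in> {1..n}" and R: "R \<noteq> {}"
  shows "(\<lambda>(i, j, h). i) ` fiber n \<mu> Y k = R" and "fiber_in n \<mu> Y k h' \<longleftrightarrow> h' = h"
proof -
  have 1: "(i, x0 + 1, h) \<in> fiber n \<mu> Y k" if "i \<in> R" for i using that w by (simp add: mem)
  show "(\<lambda>(i, j, h). i) ` fiber n \<mu> Y k = R"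
  proof (intro equalityI subsetI)
    fix i assume "i \<in> R"
    then show "i \<in> (\<lambda>(i, j, h). i) ` fiber n \<mu> Y k" using 1 by (intro image_eqI[OF _ 1]) auto
  qed (use mem in auto)
  obtain i where "(i, x0 + 1, h) \<in> fiber n \<mu> Y k" using 1 R by blast
  then show "fiber_in n \<mu> Y k h' \<longleftrightarrow> h' = h"
    using h mem by (auto simp: fiber_in_def split_paired_all)
qed

lemma marked_phi:
  assumes "marked_rgl_tabloid n \<mu> \<rho> \<gamma> l Y c"
  shows "\<exists>H I. cycle_data H I \<and> increasing_with_rows (cycle_rows H I) (phi n m \<mu> \<rho> l j Y c)"
proof -
  have Y: "rgl_tabloid n \<mu> \<rho> \<gamma> l Y"
    and c: "c \<in> {i. \<rho> i \<noteq> 0} \<rightarrow>\<^sub>E (SIGMA h:{1..n}. {1..\<gamma> h})"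
    and ch: "\<And>i h. \<rho> i \<noteq> 0 \<Longrightarrow> fiber_in n \<mu> Y i h \<Longrightarrow> fst (c i) = h"
    using assms by (auto simp: marked_rgl_tabloid_def)
  obtain H I X where t: "\<forall>k. \<rho> k \<noteq> 0 \<longrightarrow> H k \<in> {1..n} \<and> \<gamma> (H k) dvd \<rho> k \<and> I k > 0 \<and>
    (\<forall>i x h. (i, x, h) \<in> fiber n \<mu> Y k \<longleftrightarrow> h = H k \<and>
       i \<in> row_class (l (H k)) (gap (H k)) (I k) \<and> x \<in> {X k + 1..X k + \<rho> k div \<gamma> (H k)})"
    using rgl_tile_class[OF Y] by blast
  then have H: "\<And>k. \<rho> k \<noteq> 0 \<Longrightarrow> H k \<in> {1..n}" and dv: "\<And>k. \<rho> k \<noteq> 0 \<Longrightarrow> \<gamma> (H k) dvd \<rho> k"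
    and I: "\<And>k. \<rho> k \<noteq> 0 \<Longrightarrow> I k > 0" and
    mem: "\<And>k i x h. \<rho> k \<noteq> 0 \<Longrightarrow> (i, x, h) \<in> fiber n \<mu> Y k \<longleftrightarrow> h = H k \<and>
       i \<in> row_class (l (H k)) (gap (H k)) (I k) \<and> x \<in> {X k + 1..X k + \<rho> k div \<gamma> (H k)}"
    by blast+
  have w: "\<rho> k div \<gamma> (H k) \<ge> 1" if k: "\<rho> k \<noteq> 0" for k using dv[OF k] k by (auto elim!: dvdE)
  have ne: "row_class (l (H k)) (gap (H k)) (I k) \<noteq> {}" if k: "\<rho> k \<noteq> 0" for k
    using row_class_self[OF I[OF k]] by blast
  note tile = fiber_tile[OF mem w H ne]
  have fin: "fiber_in n \<mu> Y k h \<longleftrightarrow> h = H k" if k: "\<rho> k \<noteq> 0" for k h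
    using tile(2)[OF k k k k] .
  \<comment> \<open>The row chosen by the mark. It may differ from \<open>I k\<close> but has the
    same class, and shares depend only on the class.\<close>
  define I' where "I' k = sorted_list_of_set ((\<lambda>(i, j, h). i) ` fiber n \<mu> Y k) ! (snd (c k) - 1)" for k
  have I': "I' k \<in> row_class (l (H k)) (gap (H k)) (I k)" if k: "\<rho> k \<noteq> 0" for k
  proof -
    have rows: "(\<lambda>(i, j, h). i) ` fiber n \<mu> Y k = row_class (l (H k)) (gap (H k)) (I k)"
      using tile(1)[OF k k k k] .
    have "c k \<in> (SIGMA h:{1..n}. {1..\<gamma> h})" using c k by (auto simp: PiE_iff)
    moreover have "fst (c k) = H k" using ch[OF k] fin[OF k] by simp
    ultimately have "snd (c k) \<in> {1..\<gamma> (H k)}" by auto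
    moreover have "card (row_class (l (H k)) (gap (H k)) (I k)) = \<gamma> (H k)"
      using card_row_class[OF gap(1)[OF H[OF k]] l_pos[OF H[OF k]]] .
    moreover have fin: "finite (row_class (l (H k)) (gap (H k)) (I k))"
      by (simp add: row_class_eq_image[OF gap(1)[OF H[OF k]] l_pos[OF H[OF k]]])
    ultimately have "snd (c k) - 1 < length (sorted_list_of_set (row_class (l (H k)) (gap (H k)) (I k)))"
      by auto
    then have "I' k \<in> set (sorted_list_of_set (row_class (l (H k)) (gap (H k)) (I k)))"
      unfolding I'_def rows by (rule nth_mem)
    then show ?thesis using fin by simp
  qed
  have d: "cycle_data H I'"
    using H dv I' by (auto simp: cycle_data_def row_class_def)
  \<comment> \<open>The tiles partition every row, and each meets it in exactly the share of its
    cycle. This count is what makes \<open>phi\<close> exist.\<close>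
  have "(\<Sum>k | \<rho> k \<noteq> 0. row_share H I' k h i) = \<mu> h i" if h: "h \<in> {1..n}" and i: "i > 0" for h i
  proof -
    have "card (fiber n \<mu> Y k \<inter> row n \<mu> h i) = row_share H I' k h i" if k: "\<rho> k \<noteq> 0" for k
    proof (cases "h = H k \<and> i \<in> row_class (l (H k)) (gap (H k)) (I k)")
      case True
      have "fiber n \<mu> Y k \<inter> row n \<mu> h i = (\<lambda>x. (i, x, h)) ` {X k + 1..X k + \<rho> k div \<gamma> (H k)}"
      proof (intro equalityI subsetI)
        fix b assume "b \<in> (\<lambda>x. (i, x, h)) ` {X k + 1..X k + \<rho> k div \<gamma> (H k)}"
        then have "b \<in> fiber n \<mu> Y k" "\<exists>x. b = (i, x, h)" using True mem[OF k] by auto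
        then show "b \<in> fiber n \<mu> Y k \<inter> row n \<mu> h i" by (auto simp: row_def fiber_def)
      qed (use mem[OF k] in \<open>auto simp: row_def\<close>)
      then show ?thesis
        using True row_class_cong[OF I'[OF k]] by (simp add: row_share_def card_image inj_on_def)
    next
      case False
      then have "fiber n \<mu> Y k \<inter> row n \<mu> h i = {}" using mem[OF k] by (auto simp: row_def)
      then show ?thesis using False row_class_cong[OF I'[OF k]] by (auto simp: row_share_def)
    qed
    then have "(\<Sum>k | \<rho> k \<noteq> 0. row_share H I' k h i) = (\<Sum>k | \<rho> k \<noteq> 0. card (fiber n \<mu> Y k \<inter> row n \<mu> h i))"
      by simp
    also have "\<dots> = card (\<Union>k\<in>{k. \<rho> k \<noteq> 0}. fiber n \<mu> Y k \<inter> row n \<mu> h i)"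
      using finite_support finite_boxes
      by (intro card_UN_disjoint[symmetric]) (auto simp: fiber_def)
    also have "(\<Union>k\<in>{k. \<rho> k \<noteq> 0}. fiber n \<mu> Y k \<inter> row n \<mu> h i) = row n \<mu> h i"
    proof (intro equalityI subsetI)
      fix b assume b: "b \<in> row n \<mu> h i"
      then have bb: "b \<in> boxes n \<mu>" by (auto simp: row_def)
      then have "\<rho> (Y b) \<noteq> 0" and bf: "b \<in> fiber n \<mu> Y (Y b)" using rgl_support[OF Y] by blast+
      then show "b \<in> (\<Union>k\<in>{k. \<rho> k \<noteq> 0}. fiber n \<mu> Y k \<inter> row n \<mu> h i)" using b bf by blast
    qed auto
    finally show ?thesis using card_row[OF h i] by simp
  qed
  then obtain T where T: "increasing_with_rows (cycle_rows H I') T"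
    using increasing_with_cycle_rows[OF d] by blast
  have "{N. placed n \<mu> \<rho> l j Y c N h i} = cycle_rows H I' h i" for h i
    by (rule placed_eq_cycle_rows[OF d fin]) (simp_all add: I'_def)
  then have "(\<lambda>h i. {N. placed n \<mu> \<rho> l j Y c N h i}) = cycle_rows H I'" by (intro ext)
  then have "phi n m \<mu> \<rho> l j Y c = T" using T phi_eq by simp
  then show ?thesis using d T by blast
qed

end

section \<open>Fixed tabloids give tilings\<close>

context cycle_tiling
begin

text \<open>It makes the columns of a tile line up: in all rows of a class the earlier cycles take
  up equally many columns.\<close>

lemma row_share_cong:
  assumes "i' \<in> row_class (l h) (gap h) i" "i > 0"
  shows "row_share H I k h i' = row_share H I k h i"
  using assms by (auto simp: row_share_def row_class_def)

definition cycle_index :: "nat \<Rightarrow> nat" where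
  "cycle_index N = (THE k. \<exists>e<\<rho> k. N = n_start \<rho> k + e)"

lemma cycle_index_eq: "e < \<rho> k \<Longrightarrow> cycle_index (n_start \<rho> k + e) = k"
  unfolding cycle_index_def
  by (rule the_equality) (use interval_unique[OF \<rho>] in blast)+

lemma cycle_index_interval:
  assumes "N \<in> {1..box_count}"
  shows "\<exists>e<\<rho> (cycle_index N). N = n_start \<rho> (cycle_index N) + e"
  using assms cycle_index_eq unfolding interval_cover[OF \<rho>] by metis

text \<open>Later cycles consist of larger numbers. An increasing row therefore yields weakly
  increasing values of \<open>Y\<close>.\<close>

lemma cycle_index_mono:
  assumes "N \<in> {1..box_count}" "N' \<in> {1..box_count}" "N \<le> N'"
  shows "cycle_index N \<le> cycle_index N'"
proof (rule ccontr)
  assume lt: "\<not> cycle_index N \<le> cycle_index N'"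
  obtain e e' where "e < \<rho> (cycle_index N)" "N = n_start \<rho> (cycle_index N) + e"
    "e' < \<rho> (cycle_index N')" "N' = n_start \<rho> (cycle_index N') + e'"
    using assms(1,2) cycle_index_interval by metis
  then show False using interval_less[OF \<rho>, of e' "cycle_index N'" e "cycle_index N"] lt assms(3) by simp
qed

text \<open>\<open>H k\<close> and \<open>I k\<close> are read off from the place of the first
  element of cycle \<open>k\<close>; invariance forces the places of all others.\<close>

lemma invariant_numbering_cycle_rows:
  assumes T: "T \<in> numberings n m \<mu>"
    and inv: "\<And>h i. h \<in> {1..n} \<Longrightarrow> i > 0 \<Longrightarrow>
      sigma_perm \<rho> ` T ` row n \<mu> h i = T ` row n \<mu> h (shift_row (l h) j i)"
  shows "\<exists>H I. cycle_data H I \<and> (\<forall>h\<in>{1..n}. \<forall>i>0. T ` row n \<mu> h i = cycle_rows H I h i)"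
proof -
  have "\<exists>h i. \<rho> k \<noteq> 0 \<longrightarrow> h \<in> {1..n} \<and> i > 0 \<and> n_start \<rho> k \<in> T ` row n \<mu> h i" for k
  proof (cases "\<rho> k = 0")
    case False
    then have "n_start \<rho> k \<in> {1..box_count}"
      unfolding interval_cover[OF \<rho>] by (intro exI[of _ k] exI[of _ 0]) simp
    then show ?thesis unfolding numbering_row_cover[OF T, symmetric] by blast
  qed simp
  then obtain H I where HI: "\<forall>k. \<rho> k \<noteq> 0 \<longrightarrow> H k \<in> {1..n} \<and> I k > 0 \<and> n_start \<rho> k \<in> T ` row n \<mu> (H k) (I k)"
    by metis
  then have H: "\<And>k. \<rho> k \<noteq> 0 \<Longrightarrow> H k \<in> {1..n}" and I: "\<And>k. \<rho> k \<noteq> 0 \<Longrightarrow> I k > 0"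
    and st: "\<And>k. \<rho> k \<noteq> 0 \<Longrightarrow> n_start \<rho> k \<in> T ` row n \<mu> (H k) (I k)" by blast+
  have step: "sigma_perm \<rho> N \<in> T ` row n \<mu> (H k) (shift_row (l (H k)) (j * int (Suc e)) (I k))"
    if "N \<in> T ` row n \<mu> (H k) (shift_row (l (H k)) (j * int e) (I k))" "\<rho> k \<noteq> 0" for N k e
  proof -
    have "sigma_perm \<rho> N \<in> T ` row n \<mu> (H k) (shift_row (l (H k)) j (shift_row (l (H k)) (j * int e) (I k)))"
      using inv[OF H[OF that(2)] shift_row_pos] that(1) by blast
    then show ?thesis by (simp add: shift_row_shift_row[OF l_pos[OF H[OF that(2)]]] algebra_simps)
  qed
  have mem: "n_start \<rho> k + e \<in> T ` row n \<mu> (H k) (shift_row (l (H k)) (j * int e) (I k))"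
    if "e < \<rho> k" for k e
    using that
  proof (induction e)
    case 0
    then show ?case using st[of k] I[of k] by (simp add: shift_row_0)
  next
    case (Suc e)
    then show ?case using step[of "n_start \<rho> k + e" k e] sigma_perm_interval[OF \<rho>, of e k] by simp
  qed
  have "\<gamma> (H k) dvd \<rho> k" if k: "\<rho> k \<noteq> 0" for k
  proof -
    \<comment> \<open>The cycle returns to its first element after \<open>\<rho> k\<close> steps, so
      the shift by \<open>j * int (\<rho> k)\<close> fixes a row; by the criterion this is the
      divisibility.\<close>
    obtain e where e: "\<rho> k = Suc e" using k by (cases "\<rho> k") auto
    have "n_start \<rho> k \<in> T ` row n \<mu> (H k) (shift_row (l (H k)) (j * int (\<rho> k)) (I k))"
      using step[OF mem[of e k] k] sigma_perm_interval[OF \<rho>, of e k] e by simp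
    then have "shift_row (l (H k)) (j * int (\<rho> k)) (I k) = I k"
      using numbering_row_disjoint[OF T _ st[OF k]] by blast
    then show ?thesis
      unfolding \<gamma>[OF H[OF k]] using shift_row_eq_self_iff[OF l_pos[OF H[OF k]] I[OF k]] by simp
  qed
  then have d: "cycle_data H I" using H I by (simp add: cycle_data_def)
  have "T ` row n \<mu> h i = cycle_rows H I h i" if hi: "h \<in> {1..n}" "i > 0" for h i
  proof (intro equalityI subsetI)
    fix N assume N: "N \<in> T ` row n \<mu> h i"
    then have "N \<in> {1..box_count}" using hi unfolding numbering_row_cover[OF T, symmetric] by blast
    then obtain k e where e: "e < \<rho> k" "N = n_start \<rho> k + e" unfolding interval_cover[OF \<rho>] by blast
    then have "h = H k \<and> i = shift_row (l (H k)) (j * int e) (I k)"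
      using numbering_row_disjoint[OF T N] mem by blast
    then show "N \<in> cycle_rows H I h i" using e cycle_rowsI by simp
  next
    fix N assume "N \<in> cycle_rows H I h i"
    then show "N \<in> T ` row n \<mu> h i" using mem unfolding cycle_rows_def by blast
  qed
  then show ?thesis using d by blast
qed

text \<open>\<open>P\<close> will be equality with \<open>k\<close>, giving the width of a tile, and
  being less than \<open>k\<close>, giving the number of columns before it.\<close>

lemma card_row_positions:
  assumes d: "cycle_data H I" and T: "increasing_with_rows (cycle_rows H I) T"
    and hi: "h \<in> {1..n}" "i > 0"
  shows "card {x \<in> {1..\<mu> h i}. P (cycle_index (T (i, x, h)))} =
    (\<Sum>k | \<rho> k \<noteq> 0 \<and> P k. row_share H I k h i)"
proof -
  have Tn: "T \<in> numberings n m \<mu>" and r: "T ` row n \<mu> h i = cycle_rows H I h i"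
    using T hi by (simp_all add: increasing_with_rows_def)
  have inj: "inj_on (\<lambda>x. T (i, x, h)) {1..\<mu> h i}"
  proof (rule inj_onI)
    fix x y assume "x \<in> {1..\<mu> h i}" "y \<in> {1..\<mu> h i}" and eq: "T (i, x, h) = T (i, y, h)"
    then show "x = y"
      using inj_onD[OF bij_betw_imp_inj_on[OF numbering_bij[OF Tn]] eq] hi by (simp add: mem_boxes)
  qed
  have "card {x \<in> {1..\<mu> h i}. P (cycle_index (T (i, x, h)))} =
      card ((\<lambda>x. T (i, x, h)) ` {x \<in> {1..\<mu> h i}. P (cycle_index (T (i, x, h)))})"
    by (rule card_image[symmetric], rule inj_on_subset[OF inj]) auto
  also have "(\<lambda>x. T (i, x, h)) ` {x \<in> {1..\<mu> h i}. P (cycle_index (T (i, x, h)))} =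
      {N \<in> cycle_rows H I h i. P (cycle_index N)}"
    unfolding r[symmetric] row_eq[OF hi] by auto
  also have "\<dots> = {N \<in> cycle_rows H I h i. \<exists>k\<in>{k. \<rho> k \<noteq> 0 \<and> P k}. \<exists>e<\<rho> k. N = n_start \<rho> k + e}"
  proof -
    have "P (cycle_index N) \<longleftrightarrow> (\<exists>k\<in>{k. \<rho> k \<noteq> 0 \<and> P k}. \<exists>e<\<rho> k. N = n_start \<rho> k + e)"
      if N: "N \<in> cycle_rows H I h i" for N
    proof -
      obtain k e where e: "e < \<rho> k" "N = n_start \<rho> k + e" using N unfolding cycle_rows_def by blast
      show ?thesis
      proof
        assume "P (cycle_index N)"
        then have "P k" using e cycle_index_eq by simp
        then show "\<exists>k\<in>{k. \<rho> k \<noteq> 0 \<and> P k}. \<exists>e<\<rho> k. N = n_start \<rho> k + e" using e by force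
      qed (use cycle_index_eq in auto)
    qed
    then show ?thesis by blast
  qed
  also have "card \<dots> = (\<Sum>k | \<rho> k \<noteq> 0 \<and> P k. row_share H I k h i)"
    by (rule card_cycle_rows[OF d]) auto
  finally show ?thesis .
qed

lemma rgl_tabloidI:
  assumes Y: "Y \<in> boxes n \<mu> \<rightarrow>\<^sub>E {1..}"
    and card: "\<And>k. k \<ge> 1 \<Longrightarrow> card (fiber n \<mu> Y k) = \<rho> k"
    and H: "\<And>k. \<rho> k \<noteq> 0 \<Longrightarrow> H k \<in> {1..n}" and dv: "\<And>k. \<rho> k \<noteq> 0 \<Longrightarrow> \<gamma> (H k) dvd \<rho> k"
    and mem: "\<And>k i x h. \<rho> k \<noteq> 0 \<Longrightarrow> (i, x, h) \<in> fiber n \<mu> Y k \<longleftrightarrow> h = H k \<and>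
       i \<in> row_class (l (H k)) (gap (H k)) (I k) \<and> x \<in> {X k + 1..X k + \<rho> k div \<gamma> (H k)}"
    and mono: "\<And>i x y h. (i, x, h) \<in> boxes n \<mu> \<Longrightarrow> (i, y, h) \<in> boxes n \<mu> \<Longrightarrow> x \<le> y \<Longrightarrow>
        Y (i, x, h) \<le> Y (i, y, h)"
  shows "rgl_tabloid n \<mu> \<rho> \<gamma> l Y"
proof -
  have tiles: "\<exists>h\<in>{1..n}. \<exists>i' j' :: int. \<gamma> h dvd \<rho> k \<and>
        (\<lambda>(i, j, h). (int i, int j, h)) ` fiber n \<mu> Y k =
          {(int s * int (gap h) + i', int t + j', h) | s t.
             1 \<le> s \<and> s \<le> \<gamma> h \<and> 1 \<le> t \<and> t \<le> \<rho> k div \<gamma> h}" if k1: "k \<ge> 1" for k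
  proof (cases "\<rho> k = 0")
    case True
    have "finite (fiber n \<mu> Y k)" using finite_boxes by (simp add: fiber_def)
    then have "fiber n \<mu> Y k = {}" using card[OF k1] True by simp
    \<comment> \<open>For an empty fibre the column range is empty, so any component and offsets
      will do; component 1 exists by \<open>n_pos\<close>.\<close>
    then show ?thesis using True n_pos by (intro bexI[of _ 1] exI[of _ 0]) auto
  next
    case False
    let ?h = "H k" and ?b = "row_base (l (H k)) (gap (H k)) (I k)"
    have cls: "row_class (l ?h) (gap ?h) (I k) = (\<lambda>s. ?b + s * gap ?h) ` {..<\<gamma> ?h}"
      using row_class_eq_image[OF gap(1)[OF H[OF False]] l_pos[OF H[OF False]]] .
    \<comment> \<open>The counter \<open>s\<close> starts at 1, so the row offset lies one gap above
      the top row of the class.\<close>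
    have "(\<lambda>(i, j, h). (int i, int j, h)) ` fiber n \<mu> Y k =
        {(int s * int (gap ?h) + (int ?b - int (gap ?h)), int t + int (X k), ?h) | s t.
           1 \<le> s \<and> s \<le> \<gamma> ?h \<and> 1 \<le> t \<and> t \<le> \<rho> k div \<gamma> ?h}" (is "?L = ?R")
    proof (intro equalityI subsetI)
      fix p assume "p \<in> ?L"
      then obtain i x h where p: "p = (int i, int x, h)" "(i, x, h) \<in> fiber n \<mu> Y k" by auto
      then obtain s where s: "h = ?h" "s < \<gamma> ?h" "i = ?b + s * gap ?h"
        and x: "x \<in> {X k + 1..X k + \<rho> k div \<gamma> ?h}"
        unfolding mem[OF False] cls by auto
      have "p = (int (Suc s) * int (gap ?h) + (int ?b - int (gap ?h)), int (x - X k) + int (X k), ?h)"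
        using p(1) s x by (simp add: algebra_simps of_nat_diff)
      moreover have "1 \<le> Suc s" "Suc s \<le> \<gamma> ?h" "1 \<le> x - X k" "x - X k \<le> \<rho> k div \<gamma> ?h"
        using s x by auto
      ultimately show "p \<in> ?R" by blast
    next
      fix p assume "p \<in> ?R"
      then obtain s t where p: "p = (int s * int (gap ?h) + (int ?b - int (gap ?h)), int t + int (X k), ?h)"
        and s: "1 \<le> s" "s \<le> \<gamma> ?h" and t: "1 \<le> t" "t \<le> \<rho> k div \<gamma> ?h" by blast
      obtain s' where s': "s = Suc s'" using s by (cases s) auto
      have "(?b + s' * gap ?h, X k + t, ?h) \<in> fiber n \<mu> Y k"
        unfolding mem[OF False] cls using s s' t by auto
      moreover have "p = (int (?b + s' * gap ?h), int (X k + t), ?h)"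
        using p s' by (simp add: algebra_simps)
      ultimately show "p \<in> ?L" by force
    qed
    then show ?thesis using H[OF False] dv[OF False] by blast
  qed
  show ?thesis unfolding rgl_tabloid_def
    by (intro conjI allI impI) (rule Y, erule card, erule tiles, erule (2) mono)
qed

lemma invariant_numbering_marked:
  assumes T0: "T0 \<in> numberings n m \<mu>"
    and inv: "\<And>h i. h \<in> {1..n} \<Longrightarrow> i > 0 \<Longrightarrow>
      sigma_perm \<rho> ` T0 ` row n \<mu> h i = T0 ` row n \<mu> h (shift_row (l h) j i)"
  shows "\<exists>Y c. marked_rgl_tabloid n \<mu> \<rho> \<gamma> l Y c \<and>
    increasing_with_rows (\<lambda>h i. T0 ` row n \<mu> h i) (phi n m \<mu> \<rho> l j Y c)"
proof -
  obtain T where T0T: "increasing_with_rows (\<lambda>h i. T0 ` row n \<mu> h i) T"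
    using increasing_representative[OF T0] by blast
  obtain H I where d: "cycle_data H I"
    and rows: "\<forall>h\<in>{1..n}. \<forall>i>0. T0 ` row n \<mu> h i = cycle_rows H I h i"
    using invariant_numbering_cycle_rows[OF T0 inv] by blast
  have T: "increasing_with_rows (cycle_rows H I) T"
    using T0T rows by (simp add: increasing_with_rows_def)
  have Tn: "T \<in> numberings n m \<mu>" using T by (simp add: increasing_with_rows_def)
  have Tb: "T b \<in> {1..box_count}" if "b \<in> boxes n \<mu>" for b
    using bij_betwE[OF numbering_bij[OF Tn]] that by blast
  have H: "\<And>k. \<rho> k \<noteq> 0 \<Longrightarrow> H k \<in> {1..n}" and I: "\<And>k. \<rho> k \<noteq> 0 \<Longrightarrow> I k > 0"
    and dv: "\<And>k. \<rho> k \<noteq> 0 \<Longrightarrow> \<gamma> (H k) dvd \<rho> k" using d by (auto simp: cycle_data_def)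
  define Y where "Y = (\<lambda>b\<in>boxes n \<mu>. cycle_index (T b))"
  \<comment> \<open>The columns taken up by earlier cycles, measured in row \<open>I k\<close>; by
    \<open>row_share_cong\<close> every row of the class gives the same count.\<close>
  define X where "X k = (\<Sum>k' | \<rho> k' \<noteq> 0 \<and> k' < k. row_share H I k' (H k) (I k))" for k
  have mono: "Y (i, x, h) \<le> Y (i, y, h)"
    if b: "(i, x, h) \<in> boxes n \<mu>" "(i, y, h) \<in> boxes n \<mu>" "x \<le> y" for i x y h
  proof -
    have "T (i, x, h) \<le> T (i, y, h)"
      using T b unfolding increasing_with_rows_def by (metis le_less)
    then show ?thesis using cycle_index_mono[OF Tb[OF b(1)] Tb[OF b(2)]] b by (simp add: Y_def)
  qed
  \<comment> \<open>Values increase weakly along a row, so the boxes with value \<open>k\<close>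
    form one run after those of smaller value.\<close>
  have level: "{x \<in> {1..\<mu> h i}. Y (i, x, h) = k} =
      {(\<Sum>k' | \<rho> k' \<noteq> 0 \<and> k' < k. row_share H I k' h i) + 1..
       (\<Sum>k' | \<rho> k' \<noteq> 0 \<and> k' < k. row_share H I k' h i) + row_share H I k h i}"
    if h: "h \<in> {1..n}" and i: "i > 0" and k: "\<rho> k \<noteq> 0" for h i k
  proof -
    have Yx: "{x \<in> {1..\<mu> h i}. P (Y (i, x, h))} = {x \<in> {1..\<mu> h i}. P (cycle_index (T (i, x, h)))}" for P
      using h i by (auto simp: Y_def mem_boxes)
    have "{k'. \<rho> k' \<noteq> 0 \<and> k' = k} = {k}" using k by auto
    then have "card {x \<in> {1..\<mu> h i}. Y (i, x, h) = k} = row_share H I k h i"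
      unfolding Yx[of "\<lambda>y. y = k"] using card_row_positions[OF d T h i, of "\<lambda>y. y = k"] by simp
    moreover have "card {x \<in> {1..\<mu> h i}. Y (i, x, h) < k} = (\<Sum>k' | \<rho> k' \<noteq> 0 \<and> k' < k. row_share H I k' h i)"
      unfolding Yx[of "\<lambda>y. y < k"] by (rule card_row_positions[OF d T h i])
    moreover have "Y (i, x, h) \<le> Y (i, y, h)" if "1 \<le> x" "x \<le> y" "y \<le> \<mu> h i" for x y
      using mono that h i by (simp add: mem_boxes)
    ultimately show ?thesis using mono_level_set[of "\<mu> h i" "\<lambda>x. Y (i, x, h)" k] by simp
  qed
  have mem: "(i, x, h) \<in> fiber n \<mu> Y k \<longleftrightarrow> h = H k \<and>
       i \<in> row_class (l (H k)) (gap (H k)) (I k) \<and> x \<in> {X k + 1..X k + \<rho> k div \<gamma> (H k)}"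
    if k: "\<rho> k \<noteq> 0" for k i x h
  proof
    assume "(i, x, h) \<in> fiber n \<mu> Y k"
    then have h: "h \<in> {1..n}" and i: "i > 0" and x: "x \<in> {x \<in> {1..\<mu> h i}. Y (i, x, h) = k}"
      by (auto simp: fiber_def mem_boxes)
    then have ne: "row_share H I k h i \<noteq> 0" unfolding level[OF h i k] by auto
    then have hk: "h = H k" and c: "i \<in> row_class (l h) (gap h) (I k)"
      by (auto simp: row_share_def split: if_splits)
    have "row_share H I k' h i = row_share H I k' h (I k)" for k'
      using row_share_cong[OF c I[OF k]] .
    then show "h = H k \<and> i \<in> row_class (l (H k)) (gap (H k)) (I k) \<and> x \<in> {X k + 1..X k + \<rho> k div \<gamma> (H k)}"
      using x hk c row_class_self[OF I[OF k]] unfolding level[OF h i k] X_def by (simp add: row_share_def)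
  next
    assume a: "h = H k \<and> i \<in> row_class (l (H k)) (gap (H k)) (I k) \<and> x \<in> {X k + 1..X k + \<rho> k div \<gamma> (H k)}"
    then have h: "h \<in> {1..n}" and i: "i > 0" and c: "i \<in> row_class (l h) (gap h) (I k)"
      using H[OF k] by (auto simp: row_class_def)
    have "row_share H I k' h i = row_share H I k' h (I k)" for k'
      using row_share_cong[OF c I[OF k]] .
    moreover have "row_share H I k h i = \<rho> k div \<gamma> (H k)" using a by (simp add: row_share_def)
    ultimately have "x \<in> {x \<in> {1..\<mu> h i}. Y (i, x, h) = k}"
      unfolding level[OF h i k] using a by (simp add: X_def)
    then show "(i, x, h) \<in> fiber n \<mu> Y k" using h i by (simp add: fiber_def mem_boxes)
  qed
  have card: "card (fiber n \<mu> Y k) = \<rho> k" if "k \<ge> 1" for k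
  proof -
    \<comment> \<open>The entries of \<open>T\<close> in the fibre are exactly the interval of cycle
      \<open>k\<close>, so injectivity of \<open>T\<close> gives the size.\<close>
    have "T ` fiber n \<mu> Y k = (\<lambda>e. n_start \<rho> k + e) ` {..<\<rho> k}"
    proof (intro equalityI subsetI)
      fix N assume "N \<in> T ` fiber n \<mu> Y k"
      then obtain b where b: "b \<in> boxes n \<mu>" "N = T b" "cycle_index N = k" by (auto simp: fiber_def Y_def)
      then show "N \<in> (\<lambda>e. n_start \<rho> k + e) ` {..<\<rho> k}"
        using cycle_index_interval[OF Tb[OF b(1)]] by auto
    next
      fix N assume "N \<in> (\<lambda>e. n_start \<rho> k + e) ` {..<\<rho> k}"
      then obtain e where e: "e < \<rho> k" "N = n_start \<rho> k + e" by auto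
      then have "N \<in> {1..box_count}" unfolding interval_cover[OF \<rho>] by blast
      then obtain b where "b \<in> boxes n \<mu>" "N = T b"
        unfolding bij_betw_imp_surj_on[OF numbering_bij[OF Tn], symmetric] by blast
      moreover from this have "Y b = k" using e(2) cycle_index_eq[OF e(1)] by (simp add: Y_def)
      ultimately show "N \<in> T ` fiber n \<mu> Y k" by (auto simp: fiber_def)
    qed
    moreover have "inj_on T (fiber n \<mu> Y k)"
      by (rule inj_on_subset[OF bij_betw_imp_inj_on[OF numbering_bij[OF Tn]]]) (auto simp: fiber_def)
    ultimately show ?thesis using card_image[of T "fiber n \<mu> Y k"] by (simp add: card_image)
  qed
  have "Y \<in> boxes n \<mu> \<rightarrow>\<^sub>E {1..}"
  proof -
    have "cycle_index (T b) \<ge> 1" if "b \<in> boxes n \<mu>" for b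
      using cycle_index_interval[OF Tb[OF that]] interval_ne0[OF \<rho>] by (auto simp: Suc_le_eq)
    then show ?thesis by (auto simp: Y_def)
  qed
  then have rgl: "rgl_tabloid n \<mu> \<rho> \<gamma> l Y" using card H dv mem mono by (rule rgl_tabloidI)
  have w: "\<rho> k div \<gamma> (H k) \<ge> 1" if k: "\<rho> k \<noteq> 0" for k using dv[OF k] k by (auto elim!: dvdE)
  have ne: "row_class (l (H k)) (gap (H k)) (I k) \<noteq> {}" if k: "\<rho> k \<noteq> 0" for k
    using row_class_self[OF I[OF k]] by blast
  note tile = fiber_tile[OF mem w H ne]
  \<comment> \<open>\<open>s\<close> will be the rank, counted from 0, of the starting row within
    its class; the mark is \<open>Suc (s k)\<close>.\<close>
  have "\<exists>s<\<gamma> (H k). sorted_list_of_set (row_class (l (H k)) (gap (H k)) (I k)) ! s = I k"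
    if k: "\<rho> k \<noteq> 0" for k
  proof -
    let ?R = "row_class (l (H k)) (gap (H k)) (I k)"
    have "card ?R = \<gamma> (H k)" using card_row_class[OF gap(1)[OF H[OF k]] l_pos[OF H[OF k]]] .
    moreover have "finite ?R" by (simp add: row_class_eq_image[OF gap(1)[OF H[OF k]] l_pos[OF H[OF k]]])
    moreover from this have "I k \<in> set (sorted_list_of_set ?R)" using row_class_self[OF I[OF k]] by simp
    ultimately show ?thesis unfolding in_set_conv_nth by simp
  qed
  then obtain s where s: "\<And>k. \<rho> k \<noteq> 0 \<Longrightarrow> s k < \<gamma> (H k)"
    "\<And>k. \<rho> k \<noteq> 0 \<Longrightarrow> sorted_list_of_set (row_class (l (H k)) (gap (H k)) (I k)) ! s k = I k"
    by metis
  define c where "c = (\<lambda>k\<in>{k. \<rho> k \<noteq> 0}. (H k, Suc (s k)))"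
  have fin: "fiber_in n \<mu> Y k h \<longleftrightarrow> h = H k" if k: "\<rho> k \<noteq> 0" for k h
    using tile(2)[OF k k k k] .
  have "c \<in> {i. \<rho> i \<noteq> 0} \<rightarrow>\<^sub>E (SIGMA h:{1..n}. {1..\<gamma> h})"
  proof -
    have "(H k, Suc (s k)) \<in> (SIGMA h:{1..n}. {1..\<gamma> h})" if k: "\<rho> k \<noteq> 0" for k
      using H[OF k] s(1)[OF k] by auto
    then show ?thesis by (auto simp: c_def)
  qed
  moreover have "fst (c k) = h" if "\<rho> k \<noteq> 0" "fiber_in n \<mu> Y k h" for k h
    using that fin by (simp add: c_def)
  ultimately have marked: "marked_rgl_tabloid n \<mu> \<rho> \<gamma> l Y c"
    using rgl by (simp add: marked_rgl_tabloid_def)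
  have "{N. placed n \<mu> \<rho> l j Y c N h i} = cycle_rows H I h i" for h i
    by (rule placed_eq_cycle_rows[OF d fin]) (simp_all add: tile(1) c_def s(2))
  then have "(\<lambda>h i. {N. placed n \<mu> \<rho> l j Y c N h i}) = cycle_rows H I" by (intro ext)
  then have "phi n m \<mu> \<rho> l j Y c = T" using T phi_eq by simp
  then show ?thesis using marked T0T by blast
qed

end

theorem theorem4p8:
  fixes n M :: nat and m l \<gamma> \<rho> :: "nat \<Rightarrow> nat" and \<mu> :: "nat \<Rightarrow> nat \<Rightarrow> nat"
    and j :: int and \<sigma> \<tau> :: "nat \<Rightarrow> nat"
  assumes "n \<ge> 1"
    and "\<And>h. h \<in> {1..n} \<Longrightarrow> m h > 0"
    and "\<And>h. h \<in> {1..n} \<Longrightarrow> l h > 0"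
    and "M = (\<Sum>h=1..n. m h)"
    and "multi_l_partition_of n l \<mu> m"
    and "\<And>h. h \<in> {1..n} \<Longrightarrow>
           \<gamma> h = group.ord (sym_group (m h)) (a_single (\<mu> h) (l h) [^]\<^bsub>sym_group (m h)\<^esub> j)"
    and "\<sigma> \<in> carrier (sym_group M)"
    and "has_cycle_type M \<sigma> \<rho>"
    and "\<tau> \<in> carrier (sym_group M)"
    and "\<tau> \<otimes>\<^bsub>sym_group M\<^esub> sigma_perm \<rho> \<otimes>\<^bsub>sym_group M\<^esub> inv\<^bsub>sym_group M\<^esub> \<tau> = \<sigma>"
  shows "{X \<in> tabloids n m \<mu>.
            left_act_tabloid n m \<mu> \<sigma> X =
            right_act_tabloid n m \<mu> X (a_multi n m \<mu> l [^]\<^bsub>sym_group M\<^esub> (- j))} =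
         {tabloid n m \<mu> (left_act n \<mu> \<tau> (phi n m \<mu> \<rho> l j Y c)) | Y c.
            marked_rgl_tabloid n \<mu> \<rho> \<gamma> l Y c}"
proof -
  interpret multi_shape n m l \<mu> by unfold_locales (use assms in auto)
  have M: "M = box_count" by (simp add: box_count_def assms(4))
  interpret cycle_tiling n m l \<mu> \<rho> \<gamma> j
  proof
    show "partition_of \<rho> box_count" using assms(8) by (simp add: has_cycle_type_def M)
    show "\<gamma> h dvd d \<longleftrightarrow> int (l h) dvd j * int d" if "h \<in> {1..n}" for h d
      unfolding assms(6)[OF that]
      by (rule ord_a_single_pow_dvd_iff[OF l_part[OF that] l_pos[OF that] m_pos[OF that]])
  qed
  have \<sigma>p: "\<sigma> permutes {1..box_count}" and \<tau>p: "\<tau> permutes {1..box_count}"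
    using assms(7,9) by (simp_all add: sym_group_carrier M)
  have comm: "\<sigma> ` \<tau> ` A = \<tau> ` sigma_perm \<rho> ` A" for A
  proof -
    interpret G: group "sym_group M" by (rule sym_group_is_group)
    have i: "inv\<^bsub>sym_group M\<^esub> \<tau> \<circ> \<tau> = id"
      using G.l_inv[OF assms(9)] by (simp add: sym_group_mult sym_group_one)
    have "\<sigma> \<circ> \<tau> = \<tau> \<circ> sigma_perm \<rho> \<circ> (inv\<^bsub>sym_group M\<^esub> \<tau> \<circ> \<tau>)"
      unfolding assms(10)[symmetric] by (simp add: sym_group_mult comp_assoc)
    then have "\<sigma> \<circ> \<tau> = \<tau> \<circ> sigma_perm \<rho>" unfolding i by simp
    then show ?thesis by (simp add: image_comp)
  qed
  let ?a = "a_multi n m \<mu> l [^]\<^bsub>sym_group box_count\<^esub> (- j)"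
  \<comment> \<open>Translation by \<open>\<tau>\<close> replaces \<open>\<sigma>\<close> by the
    standard permutation, and then \<open>\<tau>\<close> is cancelled as an injective map. The right
    action is not disturbed, since it only moves rows.\<close>
  have fixed: "left_act_tabloid n m \<mu> \<sigma> (tabloid n m \<mu> (left_act n \<mu> \<tau> T)) =
      right_act_tabloid n m \<mu> (tabloid n m \<mu> (left_act n \<mu> \<tau> T)) ?a \<longleftrightarrow>
      (\<forall>h\<in>{1..n}. \<forall>i>0. sigma_perm \<rho> ` T ` row n \<mu> h i = T ` row n \<mu> h (shift_row (l h) j i))"
    if "T \<in> numberings n m \<mu>" for T
    unfolding tabloid_fixed_iff[OF left_act_numbering[OF that \<tau>p] \<sigma>p] left_act_row comm
      inj_image_eq_iff[OF permutes_inj[OF \<tau>p]] ..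
  show ?thesis unfolding M
  proof (intro equalityI subsetI)
    fix X assume "X \<in> {X \<in> tabloids n m \<mu>. left_act_tabloid n m \<mu> \<sigma> X = right_act_tabloid n m \<mu> X ?a}"
    then obtain T where T: "T \<in> numberings n m \<mu>" "X = tabloid n m \<mu> T"
      and eq: "left_act_tabloid n m \<mu> \<sigma> X = right_act_tabloid n m \<mu> X ?a"
      by (auto simp: tabloids_eq)
    \<comment> \<open>\<open>T0\<close> is \<open>T\<close> with the relabelling by
      \<open>\<tau>\<close> undone; its rows are permuted by the standard permutation
      itself.\<close>
    define T0 where "T0 = left_act n \<mu> (Hilbert_Choice.inv \<tau>) T"
    have T0: "T0 \<in> numberings n m \<mu>"
      unfolding T0_def by (rule left_act_numbering[OF T(1) permutes_inv[OF \<tau>p]])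
    have row0: "\<tau> ` T0 ` row n \<mu> h i = T ` row n \<mu> h i" for h i
      unfolding T0_def left_act_row by (simp add: image_image permutes_inverses(1)[OF \<tau>p])
    have X: "X = tabloid n m \<mu> (left_act n \<mu> \<tau> T0)"
      unfolding T(2) tabloid_eq_iff[OF T(1) left_act_numbering[OF T0 \<tau>p]] left_act_row row0 by simp
    obtain Y c where m: "marked_rgl_tabloid n \<mu> \<rho> \<gamma> l Y c"
      and inc: "increasing_with_rows (\<lambda>h i. T0 ` row n \<mu> h i) (phi n m \<mu> \<rho> l j Y c)"
      using invariant_numbering_marked[OF T0] eq fixed[OF T0] unfolding X by blast
    have "phi n m \<mu> \<rho> l j Y c \<in> numberings n m \<mu>" using inc by (simp add: increasing_with_rows_def)
    \<comment> \<open>A class depends only on row contents, and \<open>phi\<close> has those of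
      \<open>T0\<close>.\<close>
    then have "X = tabloid n m \<mu> (left_act n \<mu> \<tau> (phi n m \<mu> \<rho> l j Y c))"
      unfolding X using inc left_act_numbering[OF T0 \<tau>p] left_act_numbering[OF _ \<tau>p]
      by (subst tabloid_eq_iff) (auto simp: left_act_row increasing_with_rows_def)
    then show "X \<in> {tabloid n m \<mu> (left_act n \<mu> \<tau> (phi n m \<mu> \<rho> l j Y c)) | Y c.
        marked_rgl_tabloid n \<mu> \<rho> \<gamma> l Y c}" using m by blast
  next
    fix X assume "X \<in> {tabloid n m \<mu> (left_act n \<mu> \<tau> (phi n m \<mu> \<rho> l j Y c)) | Y c.
        marked_rgl_tabloid n \<mu> \<rho> \<gamma> l Y c}"
    then obtain Y c where X: "X = tabloid n m \<mu> (left_act n \<mu> \<tau> (phi n m \<mu> \<rho> l j Y c))"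
      and m: "marked_rgl_tabloid n \<mu> \<rho> \<gamma> l Y c" by blast
    obtain H I where d: "cycle_data H I"
      and inc: "increasing_with_rows (cycle_rows H I) (phi n m \<mu> \<rho> l j Y c)"
      using marked_phi[OF m] by blast
    have p: "phi n m \<mu> \<rho> l j Y c \<in> numberings n m \<mu>" using inc by (simp add: increasing_with_rows_def)
    have "left_act_tabloid n m \<mu> \<sigma> X = right_act_tabloid n m \<mu> X ?a"
      unfolding X fixed[OF p] using sigma_cycle_rows[OF d inc] by blast
    moreover have "X \<in> tabloids n m \<mu>"
      unfolding X tabloids_eq using left_act_numbering[OF p \<tau>p] by blast
    ultimately show "X \<in> {X \<in> tabloids n m \<mu>. left_act_tabloid n m \<mu> \<sigma> X = right_act_tabloid n m \<mu> X ?a}"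
      by blast
  qed
qed

end
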